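(* Let $(s_n)$ be an $s$-numbers sequence and let $X,Y$ be Banach spaces. The following are equivalent: (a) There is a constant $c>0$ such that $s_n(S(\mathcal{L}^{\mathcal{A}}(X,Y))):=\sup\{s_n(T): T\in\mathcal{L}^{\mathcal{A}}(X,Y),\ \|T\|=1\}>c$ for all $n\in\mathbb{N}$. (b) For every non-increasing sequence $\{\varepsilon_n\}\in c_0$ there is an approximable operator $T\in\mathcal{L}^{\mathcal{A}}(X,Y)$ such that $s_n(T)\neq\mathbf{O}(\varepsilon_n)$.
   Context: $\mathcal{L}(X,Y)$ is the space of bounded linear operators from $X$ to $Y$. $\mathcal{L}^{\mathcal{A}}(X,Y)$, the space of approximable operators, is the closure in $\mathcal{L}(X,Y)$ (operator norm) of the finite-rank operators; it is equipped with the operator norm. An $s$-numbers sequence is a rule that associates to every bounded linear operator $T$ between Banach spaces a sequence $(s_n(T))_{n\ge1}$ of non-negative numbers such that, for all Banach spaces $X,Y,Z$: (i) $\|T\|=s_1(T)\ge s_2(T)\ge\cdots\ge0$; (ii) $s_{n+m-1}(T+S)\le s_n(T)+s_m(S)$ for $S,T\in\mathcal{L}(X,Y)$, $n,m\ge1$; (iii) $s_{n+m-1}(TS)\le s_n(T)s_m(S)$ for $S\in\mathcal{L}(X,Y)$, $T\in\mathcal{L}(Y,Z)$, $n,m\ge1$; (iv) $s_n(1_d:\ell_2^n\to\ell_2^n)=1$ for the identity operator on $\ell_2^n$, $n\ge1$; (v) $s_n(T)=0$ if $\mathrm{rank}(T)<n$. $c_0$ is the space of real sequences converging to $0$. $s_n(T)=\mathbf{O}(\varepsilon_n)$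 means that there is a constant $C$ with $s_n(T)\le C\varepsilon_n$ for all $n\in\mathbb{N}$. *)

theory Defs
  imports "HOL-Analysis.Analysis" "HOL-Algebra.Module"
begin

text \<open>
  An s-numbers sequence is a rule on the class of all bounded operators between all Banach spaces,
  so Banach spaces have to be objects one can quantify over.  They are modelled as records
  whose underlying set is a subset of a type \<open>'u\<close>, which is arbitrary and plays the role of
  a universe: every set-sized family of Banach spaces fits in a suitable \<open>'u\<close>, and a rule on all
  Banach spaces restricts to a rule on those in \<open>'u\<close>.

  The scalars are a type \<open>'k\<close> of class \<open>real_normed_field\<close>; by the Gelfand-Mazur theorem this
  is exactly the real or the complex field.
\<close>

definition scalars :: "'k::real_normed_field ring" where
  "scalars = \<lparr>carrier = UNIV, mult = (*), one = 1, zero = 0, add = (+)\<rparr>"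

text \<open>The library's module record extends the ring record; its fields \<open>mult\<close> and \<open>one\<close> are
  not used for modules.\<close>

record ('k, 'u) nspace = "('k, 'u) module" +
  vnorm :: "'u \<Rightarrow> real"  (\<open>\<parallel>_\<parallel>\<index>\<close>)

text \<open>The value outside the carrier is chosen because the locale \<open>Metric_space\<close> demands
  non-negativity and symmetry there, too.\<close>

definition vdist :: "('k, 'u, 'm) nspace_scheme \<Rightarrow> 'u \<Rightarrow> 'u \<Rightarrow> real" where
  "vdist X x y =
    (if x \<in> carrier X \<and> y \<in> carrier X then \<parallel>x \<ominus>\<^bsub>X\<^esub> y\<parallel>\<^bsub>X\<^esub> else 0)"

locale normed_vs = module scalars X
  for X :: "('k::real_normed_field, 'u) nspace" (structure) +
  assumes vnorm_nonneg: "x \<in> carrier X \<Longrightarrow> 0 \<le> \<parallel>x\<parallel>"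
    and vnorm_eq_0: "x \<in> carrier X \<Longrightarrow> \<parallel>x\<parallel> = 0 \<longleftrightarrow> x = \<zero>"
    and vnorm_triangle: "\<lbrakk>x \<in> carrier X; y \<in> carrier X\<rbrakk> \<Longrightarrow> \<parallel>x \<oplus> y\<parallel> \<le> \<parallel>x\<parallel> + \<parallel>y\<parallel>"
    and vnorm_smult: "x \<in> carrier X \<Longrightarrow> \<parallel>a \<odot> x\<parallel> = norm a * \<parallel>x\<parallel>"

locale banach_space = normed_vs X
  for X :: "('k::real_normed_field, 'u) nspace" (structure) +
  assumes complete: "Metric_space.mcomplete (carrier X) (vdist X)"

text \<open>Operators are extensional functions, so that an operator is determined by its values on
  the domain space.\<close>

definition linear_maps ::
    "('k::real_normed_field, 'u) nspace \<Rightarrow> ('k, 'v) nspace \<Rightarrow> ('u \<Rightarrow> 'v) set" where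
  "linear_maps X Y = {T \<in> carrier X \<rightarrow>\<^sub>E carrier Y.
     (\<forall>x\<in>carrier X. \<forall>y\<in>carrier X. T (x \<oplus>\<^bsub>X\<^esub> y) = T x \<oplus>\<^bsub>Y\<^esub> T y) \<and>
     (\<forall>a. \<forall>x\<in>carrier X. T (a \<odot>\<^bsub>X\<^esub> x) = a \<odot>\<^bsub>Y\<^esub> T x)}"

definition bounded_ops ::
    "('k::real_normed_field, 'u) nspace \<Rightarrow> ('k, 'v) nspace \<Rightarrow> ('u \<Rightarrow> 'v) set" where
  "bounded_ops X Y =
     {T \<in> linear_maps X Y. \<exists>C. \<forall>x\<in>carrier X. \<parallel>T x\<parallel>\<^bsub>Y\<^esub> \<le> C * \<parallel>x\<parallel>\<^bsub>X\<^esub>}"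

definition op_norm ::
    "('k::real_normed_field, 'u) nspace \<Rightarrow> ('k, 'v) nspace \<Rightarrow> ('u \<Rightarrow> 'v) \<Rightarrow> real" where
  "op_norm X Y T = (SUP x\<in>{x \<in> carrier X. \<parallel>x\<parallel>\<^bsub>X\<^esub> \<le> 1}. \<parallel>T x\<parallel>\<^bsub>Y\<^esub>)"

definition op_add ::
    "('k, 'u) nspace \<Rightarrow> ('k, 'v) nspace \<Rightarrow> ('u \<Rightarrow> 'v) \<Rightarrow> ('u \<Rightarrow> 'v) \<Rightarrow> 'u \<Rightarrow> 'v" where
  "op_add X Y T S = (\<lambda>x\<in>carrier X. T x \<oplus>\<^bsub>Y\<^esub> S x)"

definition op_minus ::
    "('k, 'u) nspace \<Rightarrow> ('k, 'v) nspace \<Rightarrow> ('u \<Rightarrow> 'v) \<Rightarrow> ('u \<Rightarrow> 'v) \<Rightarrow> 'u \<Rightarrow> 'v" where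
  "op_minus X Y T S = (\<lambda>x\<in>carrier X. T x \<ominus>\<^bsub>Y\<^esub> S x)"

definition op_dist ::
    "('k::real_normed_field, 'u) nspace \<Rightarrow> ('k, 'v) nspace \<Rightarrow> ('u \<Rightarrow> 'v) \<Rightarrow> ('u \<Rightarrow> 'v) \<Rightarrow> real"
  where
  "op_dist X Y T S =
    (if T \<in> bounded_ops X Y \<and> S \<in> bounded_ops X Y then op_norm X Y (op_minus X Y T S) else 0)"

definition vspan :: "('k::real_normed_field, 'u) nspace \<Rightarrow> 'u set \<Rightarrow> 'u set" where
  "vspan X B = (\<lambda>N. submodule N scalars X) hull B"

text \<open>The dimension of a subspace is the least size of a finite spanning set, and \<open>\<infinity>\<close>
  (the infimum of the empty set) if there is none.\<close>

definition vdim :: "('k::real_normed_field, 'u) nspace \<Rightarrow> 'u set \<Rightarrow> enat" where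
  "vdim X V = (INF B\<in>{B. finite B \<and> B \<subseteq> V \<and> vspan X B = V}. enat (card B))"

definition op_rank ::
    "('k::real_normed_field, 'u) nspace \<Rightarrow> ('k, 'v) nspace \<Rightarrow> ('u \<Rightarrow> 'v) \<Rightarrow> enat" where
  "op_rank X Y T = vdim Y (T ` carrier X)"

definition finite_rank_ops ::
    "('k::real_normed_field, 'u) nspace \<Rightarrow> ('k, 'v) nspace \<Rightarrow> ('u \<Rightarrow> 'v) set" where
  "finite_rank_ops X Y = {T \<in> bounded_ops X Y. op_rank X Y T < \<infinity>}"

definition approximable_ops ::
    "('k::real_normed_field, 'u) nspace \<Rightarrow> ('k, 'v) nspace \<Rightarrow> ('u \<Rightarrow> 'v) set" where
  "approximable_ops X Y =
     Metric_space.mtopology (bounded_ops X Y) (op_dist X Y) closure_of finite_rank_ops X Y"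

definition ell2 :: "nat \<Rightarrow> ('k::real_normed_field, nat \<Rightarrow> 'k) nspace" where
  "ell2 n = \<lparr>carrier = {v. \<forall>i\<ge>n. v i = 0}, mult = undefined, one = undefined,
     zero = (\<lambda>i. 0), add = (\<lambda>v w i. v i + w i), smult = (\<lambda>a v i. a * v i),
     vnorm = (\<lambda>v. L2_set (\<lambda>i. norm (v i)) {..<n})\<rparr>"

definition isometrically_isomorphic ::
    "('k::real_normed_field, 'u) nspace \<Rightarrow> ('k, 'v) nspace \<Rightarrow> bool" where
  "isometrically_isomorphic X Y \<longleftrightarrow>
     (\<exists>J\<in>linear_maps X Y. bij_betw J (carrier X) (carrier Y) \<and>
        (\<forall>x\<in>carrier X. \<parallel>J x\<parallel>\<^bsub>Y\<^esub> = \<parallel>x\<parallel>\<^bsub>X\<^esub>))"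

text \<open>
  \<open>s X Y T n\<close> is \<open>s\<^sub>n(T)\<close> for \<open>T\<close> from \<open>X\<close> to \<open>Y\<close>; indices start at 1 and \<open>s X Y T 0\<close> is
  irrelevant.  In \<open>s_ell2\<close>, the space \<open>E\<close> ranges over the copies of \<open>\<ell>\<^sub>2\<^sup>n\<close> inside the universe.
  These exist as soon as \<open>'u\<close> carries any non-zero Banach space: it then has at least the
  cardinality of the scalar field.
\<close>

locale s_numbers_sequence =
  fixes s :: "('k::real_normed_field, 'u) nspace \<Rightarrow> ('k, 'u) nspace \<Rightarrow> ('u \<Rightarrow> 'u) \<Rightarrow> nat \<Rightarrow> real"
  assumes s_one: "\<lbrakk>banach_space X; banach_space Y; T \<in> bounded_ops X Y\<rbrakk>
      \<Longrightarrow> s X Y T 1 = op_norm X Y T"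
    and s_decreasing: "\<lbrakk>banach_space X; banach_space Y; T \<in> bounded_ops X Y; n \<ge> 1\<rbrakk>
      \<Longrightarrow> s X Y T (n + 1) \<le> s X Y T n"
    and s_nonneg: "\<lbrakk>banach_space X; banach_space Y; T \<in> bounded_ops X Y; n \<ge> 1\<rbrakk>
      \<Longrightarrow> 0 \<le> s X Y T n"
    and s_add: "\<lbrakk>banach_space X; banach_space Y; T \<in> bounded_ops X Y; S \<in> bounded_ops X Y;
        n \<ge> 1; m \<ge> 1\<rbrakk>
      \<Longrightarrow> s X Y (op_add X Y T S) (n + m - 1) \<le> s X Y T n + s X Y S m"
    and s_mult: "\<lbrakk>banach_space X; banach_space Y; banach_space Z;
        S \<in> bounded_ops X Y; T \<in> bounded_ops Y Z; n \<ge> 1; m \<ge> 1\<rbrakk>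
      \<Longrightarrow> s X Z (compose (carrier X) T S) (n + m - 1) \<le> s Y Z T n * s X Y S m"
    and s_ell2: "\<lbrakk>banach_space E; isometrically_isomorphic (ell2 n) E; n \<ge> 1\<rbrakk>
      \<Longrightarrow> s E E (\<lambda>x\<in>carrier E. x) n = 1"
    and s_rank: "\<lbrakk>banach_space X; banach_space Y; T \<in> bounded_ops X Y; n \<ge> 1;
        op_rank X Y T < enat n\<rbrakk>
      \<Longrightarrow> s X Y T n = 0"

text \<open>The supremum over the unit sphere is taken in the extended reals because the sphere is
  empty if \<open>X\<close> or \<open>Y\<close> is zero.\<close>

definition s_sphere ::
    "(('k::real_normed_field, 'u) nspace \<Rightarrow> ('k, 'u) nspace \<Rightarrow> ('u \<Rightarrow> 'u) \<Rightarrow> nat \<Rightarrow> real)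
      \<Rightarrow> ('k, 'u) nspace \<Rightarrow> ('k, 'u) nspace \<Rightarrow> nat \<Rightarrow> ereal" where
  "s_sphere s X Y n = (SUP T\<in>{T \<in> approximable_ops X Y. op_norm X Y T = 1}. ereal (s X Y T n))"

text \<open>The metric-space notions used above are meaningful:\<close>

context normed_vs
begin

lemma uminus_eq: "x \<in> carrier X \<Longrightarrow> \<ominus> x = (- 1) \<odot> x"
proof -
  assume x: "x \<in> carrier X"
  have c: "a \<in> carrier scalars" for a :: 'k by (simp add: scalars_def)
  have "(- 1) \<odot> x \<oplus> x = ((- 1) \<oplus>\<^bsub>scalars\<^esub> 1) \<odot> x"
    using smult_l_distr[OF c c x, of "-1" 1] smult_one[OF x] by (simp add: scalars_def)
  also have "\<dots> = \<zero>"
    using smult_l_null[OF x] by (simp add: scalars_def)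
  finally show ?thesis
    using x c by (simp add: M.minus_equality)
qed

lemma vnorm_minus: "x \<in> carrier X \<Longrightarrow> \<parallel>\<ominus> x\<parallel> = \<parallel>x\<parallel>"
  by (simp add: uminus_eq vnorm_smult)

lemma minus_eq_zero_iff:
  "\<lbrakk>x \<in> carrier X; y \<in> carrier X\<rbrakk> \<Longrightarrow> x \<ominus> y = \<zero> \<longleftrightarrow> x = y"
  using M.minus_equality[of x "\<ominus> y"] by (auto simp: M.minus_eq M.r_neg)

lemma Metric_space_vdist: "Metric_space (carrier X) (vdist X)"
proof
  show "0 \<le> vdist X x y" for x y
    by (simp add: vdist_def vnorm_nonneg)
  show "vdist X x y = vdist X y x" for x y
    using vnorm_minus[of "x \<ominus> y"]
    by (auto simp: vdist_def M.minus_eq M.minus_add M.a_comm)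
  show "vdist X x y = 0 \<longleftrightarrow> x = y" if "x \<in> carrier X" "y \<in> carrier X" for x y
    using that by (simp add: vdist_def vnorm_eq_0 minus_eq_zero_iff)
  show "vdist X x z \<le> vdist X x y + vdist X y z"
    if "x \<in> carrier X" "y \<in> carrier X" "z \<in> carrier X" for x y z
  proof -
    have "x \<ominus> z = (x \<ominus> y) \<oplus> (y \<ominus> z)"
      using that by (simp add: M.minus_eq M.a_assoc M.r_neg1)
    then show ?thesis
      using that vnorm_triangle[of "x \<ominus> y" "y \<ominus> z"] by (simp add: vdist_def)
  qed
qed

end

lemma op_norm_bdd:
  assumes "normed_vs X" "T \<in> bounded_ops X Y"
  shows "bdd_above ((\<lambda>x. \<parallel>T x\<parallel>\<^bsub>Y\<^esub>) ` {x \<in> carrier X. \<parallel>x\<parallel>\<^bsub>X\<^esub> \<le> 1})"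
proof -
  interpret X: normed_vs X by fact
  obtain C where C: "\<And>x. x \<in> carrier X \<Longrightarrow> \<parallel>T x\<parallel>\<^bsub>Y\<^esub> \<le> C * \<parallel>x\<parallel>\<^bsub>X\<^esub>"
    using assms by (auto simp: bounded_ops_def)
  have "\<parallel>T x\<parallel>\<^bsub>Y\<^esub> \<le> \<bar>C\<bar>" if "x \<in> carrier X" "\<parallel>x\<parallel>\<^bsub>X\<^esub> \<le> 1" for x
  proof -
    have "C * \<parallel>x\<parallel>\<^bsub>X\<^esub> \<le> \<bar>C\<bar> * 1"
      using that X.vnorm_nonneg[of x] by (intro mult_mono) auto
    then show ?thesis using C[OF that(1)] by simp
  qed
  then show ?thesis by (intro bdd_aboveI2[where M = "\<bar>C\<bar>"]) auto
qed

lemma op_norm_upper: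
  assumes "normed_vs X" "T \<in> bounded_ops X Y" "x \<in> carrier X" "\<parallel>x\<parallel>\<^bsub>X\<^esub> \<le> 1"
  shows "\<parallel>T x\<parallel>\<^bsub>Y\<^esub> \<le> op_norm X Y T"
  unfolding op_norm_def using assms by (intro cSUP_upper op_norm_bdd) auto

lemma op_norm_least:
  assumes "normed_vs X" "\<And>x. \<lbrakk>x \<in> carrier X; \<parallel>x\<parallel>\<^bsub>X\<^esub> \<le> 1\<rbrakk> \<Longrightarrow> \<parallel>T x\<parallel>\<^bsub>Y\<^esub> \<le> c"
  shows "op_norm X Y T \<le> c"
proof -
  interpret X: normed_vs X by fact
  have "\<parallel>\<zero>\<^bsub>X\<^esub>\<parallel>\<^bsub>X\<^esub> = 0" using X.vnorm_eq_0 by simp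
  then have "\<zero>\<^bsub>X\<^esub> \<in> {x \<in> carrier X. \<parallel>x\<parallel>\<^bsub>X\<^esub> \<le> 1}" by simp
  then show ?thesis
    unfolding op_norm_def using assms(2) by (intro cSUP_least) auto
qed

lemma op_minus_bounded:
  fixes X :: "('k::real_normed_field, 'u) nspace" and Y :: "('k, 'v) nspace"
  assumes "normed_vs X" "normed_vs Y" "T \<in> bounded_ops X Y" "S \<in> bounded_ops X Y"
  shows "op_minus X Y T S \<in> bounded_ops X Y"
proof -
  interpret X: normed_vs X by fact
  interpret Y: normed_vs Y by fact
  have c: "a \<in> carrier scalars" for a :: 'k by (simp add: scalars_def)
  have T: "T x \<in> carrier Y" "S x \<in> carrier Y" if "x \<in> carrier X" for x
    using assms(3,4) that by (auto simp: bounded_ops_def linear_maps_def)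
  have lin: "T (x \<oplus>\<^bsub>X\<^esub> y) = T x \<oplus>\<^bsub>Y\<^esub> T y" "S (x \<oplus>\<^bsub>X\<^esub> y) = S x \<oplus>\<^bsub>Y\<^esub> S y"
    "T (a \<odot>\<^bsub>X\<^esub> x) = a \<odot>\<^bsub>Y\<^esub> T x" "S (a \<odot>\<^bsub>X\<^esub> x) = a \<odot>\<^bsub>Y\<^esub> S x"
    if "x \<in> carrier X" "y \<in> carrier X" for x y a
    using assms(3,4) that by (auto simp: bounded_ops_def linear_maps_def)
  obtain C D where CD: "\<And>x. x \<in> carrier X \<Longrightarrow> \<parallel>T x\<parallel>\<^bsub>Y\<^esub> \<le> C * \<parallel>x\<parallel>\<^bsub>X\<^esub>"
      "\<And>x. x \<in> carrier X \<Longrightarrow> \<parallel>S x\<parallel>\<^bsub>Y\<^esub> \<le> D * \<parallel>x\<parallel>\<^bsub>X\<^esub>"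
    using assms(3,4) unfolding bounded_ops_def by auto
  have "\<parallel>T x \<ominus>\<^bsub>Y\<^esub> S x\<parallel>\<^bsub>Y\<^esub> \<le> (C + D) * \<parallel>x\<parallel>\<^bsub>X\<^esub>" if x: "x \<in> carrier X" for x
    using Y.vnorm_triangle[of "T x" "\<ominus>\<^bsub>Y\<^esub> S x"] Y.vnorm_minus[of "S x"] T[OF x] CD[OF x]
    by (simp add: Y.M.minus_eq algebra_simps)
  moreover have "op_minus X Y T S \<in> linear_maps X Y"
    using c T lin
    by (auto simp: linear_maps_def op_minus_def Y.M.minus_eq Y.M.minus_add Y.M.a_ac
        Y.smult_r_distr Y.smult_r_minus)
  ultimately show ?thesis
    by (auto simp: bounded_ops_def op_minus_def)
qed

lemma Metric_space_op_dist:
  fixes X :: "('k::real_normed_field, 'u) nspace" and Y :: "('k, 'v) nspace"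
  assumes "normed_vs X" "normed_vs Y"
  shows "Metric_space (bounded_ops X Y) (op_dist X Y)"
proof -
  interpret X: normed_vs X by fact
  interpret Y: normed_vs Y by fact
  have zero: "\<parallel>\<zero>\<^bsub>X\<^esub>\<parallel>\<^bsub>X\<^esub> = 0" using X.vnorm_eq_0 by simp
  have carr: "T x \<in> carrier Y" if "T \<in> bounded_ops X Y" "x \<in> carrier X" for T x
    using that by (auto simp: bounded_ops_def linear_maps_def)
  note upper = op_norm_upper[OF assms(1)] and least = op_norm_least[OF assms(1)]
    and mb = op_minus_bounded[OF assms]
  have nonneg: "0 \<le> op_norm X Y T" if T: "T \<in> bounded_ops X Y" for T
    using upper[OF T X.M.zero_closed] zero Y.vnorm_nonneg[OF carr[OF T X.M.zero_closed]] by simp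
  have comm: "op_norm X Y (op_minus X Y T S) = op_norm X Y (op_minus X Y S T)"
    if "T \<in> bounded_ops X Y" "S \<in> bounded_ops X Y" for T S
    unfolding op_norm_def
  proof (rule SUP_cong[OF refl])
    fix x assume "x \<in> {x \<in> carrier X. \<parallel>x\<parallel>\<^bsub>X\<^esub> \<le> 1}"
    then show "\<parallel>op_minus X Y T S x\<parallel>\<^bsub>Y\<^esub> = \<parallel>op_minus X Y S T x\<parallel>\<^bsub>Y\<^esub>"
      using carr that Y.vnorm_minus[of "T x \<ominus>\<^bsub>Y\<^esub> S x"]
      by (auto simp: op_minus_def Y.M.minus_eq Y.M.minus_add Y.M.a_comm)
  qed
  show ?thesis
  proof
    show "0 \<le> op_dist X Y T S" for T S
      by (simp add: op_dist_def nonneg mb)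
    show "op_dist X Y T S = op_dist X Y S T" for T S
      by (simp add: op_dist_def comm)
    show "op_dist X Y T S = 0 \<longleftrightarrow> T = S"
      if T: "T \<in> bounded_ops X Y" and S: "S \<in> bounded_ops X Y" for T S
    proof
      assume "op_dist X Y T S = 0"
      then have 0: "op_norm X Y (op_minus X Y T S) = 0" using T S by (simp add: op_dist_def)
      have "T x = S x" if x: "x \<in> carrier X" for x
      proof -
        define a :: 'k where "a = of_real (inverse (\<parallel>x\<parallel>\<^bsub>X\<^esub> + 1))"
        have n: "0 \<le> \<parallel>x\<parallel>\<^bsub>X\<^esub>" using X.vnorm_nonneg x by simp
        then have a: "norm a > 0" "norm a * \<parallel>x\<parallel>\<^bsub>X\<^esub> \<le> 1"
          unfolding a_def norm_of_real by (auto simp: field_simps)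
        have ca: "a \<in> carrier scalars" by (simp add: scalars_def)
        have ax: "a \<odot>\<^bsub>X\<^esub> x \<in> carrier X" using x ca by simp
        have eq: "op_minus X Y T S (a \<odot>\<^bsub>X\<^esub> x) = a \<odot>\<^bsub>Y\<^esub> op_minus X Y T S x"
          using mb[OF T S] x by (auto simp: bounded_ops_def linear_maps_def)
        have d: "op_minus X Y T S x \<in> carrier Y" using carr[OF mb[OF T S] x] .
        have "norm a * \<parallel>op_minus X Y T S x\<parallel>\<^bsub>Y\<^esub> \<le> 0"
          using upper[OF mb[OF T S] ax] a x 0 by (simp add: X.vnorm_smult Y.vnorm_smult eq d)
        then have "\<parallel>op_minus X Y T S x\<parallel>\<^bsub>Y\<^esub> = 0"
          using a Y.vnorm_nonneg[OF d] by (simp add: mult_le_0_iff)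
        then show ?thesis
          using Y.vnorm_eq_0[OF d] x carr[OF T x] carr[OF S x]
          by (simp add: op_minus_def Y.minus_eq_zero_iff)
      qed
      then show "T = S"
        using T S by (auto simp: bounded_ops_def linear_maps_def intro: PiE_ext)
    next
      assume "T = S"
      moreover have "op_norm X Y (op_minus X Y S S) \<le> 0"
        using S carr[OF S] Y.vnorm_eq_0[of "\<zero>\<^bsub>Y\<^esub>"]
        by (intro least) (simp add: op_minus_def Y.M.minus_eq Y.M.r_neg)
      ultimately show "op_dist X Y T S = 0"
        using nonneg[OF mb[OF S S]] S by (simp add: op_dist_def)
    qed
    show "op_dist X Y T U \<le> op_dist X Y T S + op_dist X Y S U"
      if T: "T \<in> bounded_ops X Y" and S: "S \<in> bounded_ops X Y" and U: "U \<in> bounded_ops X Y"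
      for T S U
    proof -
      have "op_norm X Y (op_minus X Y T U)
          \<le> op_norm X Y (op_minus X Y T S) + op_norm X Y (op_minus X Y S U)"
      proof (rule least)
        fix x assume x: "x \<in> carrier X" "\<parallel>x\<parallel>\<^bsub>X\<^esub> \<le> 1"
        note c = carr[OF T x(1)] carr[OF S x(1)] carr[OF U x(1)]
        have "T x \<ominus>\<^bsub>Y\<^esub> U x = (T x \<ominus>\<^bsub>Y\<^esub> S x) \<oplus>\<^bsub>Y\<^esub> (S x \<ominus>\<^bsub>Y\<^esub> U x)"
          using c by (simp add: Y.M.minus_eq Y.M.a_assoc Y.M.r_neg1)
        then show "\<parallel>op_minus X Y T U x\<parallel>\<^bsub>Y\<^esub>
            \<le> op_norm X Y (op_minus X Y T S) + op_norm X Y (op_minus X Y S U)"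
          using Y.vnorm_triangle[of "T x \<ominus>\<^bsub>Y\<^esub> S x" "S x \<ominus>\<^bsub>Y\<^esub> U x"] c x
            upper[OF mb[OF T S] x] upper[OF mb[OF S U] x]
          by (simp add: op_minus_def)
      qed
      then show ?thesis using T S U by (simp add: op_dist_def)
    qed
  qed
qed

end

theory Submission
  imports Defs
begin

text \<open>
  If (b) holds but (a) fails, (b) applied to the supremum of \<open>s\<^sub>n\<close> over the unit ball of the
  approximable operators, which then tends to 0, contradicts \<open>s\<^sub>n(a T) \<le> \<bar>a\<bar> s\<^sub>n(T)\<close>.
  Conversely, if \<open>s\<^sub>n(T) = O(\<epsilon>\<^sub>n)\<close> for every approximable \<open>T\<close>, then by Baire's theorem one of
  the closed sets \<open>{T. \<forall>n. s\<^sub>n(T) \<le> k \<epsilon>\<^sub>n}\<close> contains a ball, and the additivity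
  \<open>s\<^bsub>2n-1\<^esub>(T + S) \<le> s\<^sub>n(T) + s\<^sub>n(S)\<close> turns this into \<open>s\<^bsub>2n-1\<^esub>(T) = O(\<epsilon>\<^sub>n)\<close> uniformly on the
  unit sphere, which contradicts (a).
\<close>

section \<open>Finitely spanned subspaces\<close>

lemma scalars_simps [simp]:
  "carrier (scalars :: 'k::real_normed_field ring) = UNIV"
  "mult (scalars :: 'k ring) = (*)" "one (scalars :: 'k ring) = 1"
  "zero (scalars :: 'k ring) = 0" "add (scalars :: 'k ring) = (+)"
  by (simp_all add: scalars_def)

context normed_vs
begin

lemma smult_0 [simp]: "x \<in> carrier X \<Longrightarrow> 0 \<odot> x = \<zero>"
  using smult_l_null[of x] by simp

lemma smult_1 [simp]: "x \<in> carrier X \<Longrightarrow> 1 \<odot> x = x"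
  using smult_one[of x] by simp

lemma smult_in [simp, intro]: "x \<in> carrier X \<Longrightarrow> a \<odot> x \<in> carrier X"
  by (rule smult_closed) simp_all

lemma smult_add_left: "x \<in> carrier X \<Longrightarrow> (a + b) \<odot> x = a \<odot> x \<oplus> b \<odot> x"
  using smult_l_distr[of a b x] by simp

lemma smult_add_right:
  "\<lbrakk>x \<in> carrier X; y \<in> carrier X\<rbrakk> \<Longrightarrow> a \<odot> (x \<oplus> y) = a \<odot> x \<oplus> a \<odot> y"
  using smult_r_distr[of a x y] by simp

lemma smult_smult: "x \<in> carrier X \<Longrightarrow> a \<odot> (b \<odot> x) = (a * b) \<odot> x"
  using smult_assoc1[of a b x] by simp

lemma smult_minus_right: "x \<in> carrier X \<Longrightarrow> a \<odot> (\<ominus> x) = \<ominus> (a \<odot> x)"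
  using smult_r_minus[of a x] by simp

lemma vnorm_zero [simp]: "\<parallel>\<zero>\<parallel> = 0"
  using vnorm_eq_0 by simp

section \<open>Submodules, spans and finite dimension\<close>

lemma submoduleI':
  assumes "H \<subseteq> carrier X" "\<zero> \<in> H"
    and "\<And>x y. \<lbrakk>x \<in> H; y \<in> H\<rbrakk> \<Longrightarrow> x \<oplus> y \<in> H" "\<And>a x. x \<in> H \<Longrightarrow> a \<odot> x \<in> H"
  shows "submodule H scalars X"
  \<comment> \<open>Closure under negation comes from closure under multiples, since
    \<open>\<ominus> x\<close> is the multiple of \<open>x\<close> by -1.\<close>
  using assms by (intro submoduleI) (auto simp: uminus_eq subset_iff)

lemma submoduleD:
  assumes "submodule H scalars X"
  shows "H \<subseteq> carrier X" "\<zero> \<in> H" "\<And>x y. \<lbrakk>x \<in> H; y \<in> H\<rbrakk> \<Longrightarrow> x \<oplus> y \<in> H"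
    "\<And>a x. x \<in> H \<Longrightarrow> a \<odot> x \<in> H"
proof -
  note E = submoduleE[OF assms]
  show "H \<subseteq> carrier X" by (rule E)
  show sm: "a \<odot> x \<in> H" if "x \<in> H" for a x using E(4) that by simp
  show "x \<oplus> y \<in> H" if "x \<in> H" "y \<in> H" for x y using E(5) that by simp
  \<comment> \<open>\<open>E(2)\<close> gives non-emptiness; the multiple by 0 of any element is
    zero.\<close>
  obtain x where "x \<in> H" using E(2) by blast
  then show "\<zero> \<in> H" using sm[of x 0] E(1) by auto
qed

lemma submodule_vspan:
  assumes "B \<subseteq> carrier X"
  shows "submodule (vspan X B) scalars X"
proof (rule submoduleI')
  show "vspan X B \<subseteq> carrier X"
    unfolding vspan_def using assms carrier_is_submodule by (intro hull_minimal)
qed (auto simp: vspan_def hull_def dest: submoduleD)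

lemma vspan_superset: "B \<subseteq> vspan X B"
  unfolding vspan_def by (rule hull_subset)

lemma vspan_minimal: "\<lbrakk>B \<subseteq> V; submodule V scalars X\<rbrakk> \<Longrightarrow> vspan X B \<subseteq> V"
  unfolding vspan_def by (rule hull_minimal)

lemma vspan_mono: "A \<subseteq> B \<Longrightarrow> vspan X A \<subseteq> vspan X B"
  unfolding vspan_def by (rule hull_mono)

lemma vspan_empty: "vspan X {} = {\<zero>}"
proof
  show "vspan X {} \<subseteq> {\<zero>}"
    by (intro vspan_minimal submoduleI') (auto simp: smult_r_null)
  show "{\<zero>} \<subseteq> vspan X {}"
    using submoduleD(2)[OF submodule_vspan[of "{}"]] by simp
qed

text \<open>The vectors of this form are a submodule containing \<open>insert b B\<close>, and the
  span is the least such submodule.\<close>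

lemma vspan_insertD:
  assumes B: "B \<subseteq> carrier X" and b: "b \<in> carrier X" and v: "v \<in> vspan X (insert b B)"
  obtains k w where "w \<in> vspan X B" "v = k \<odot> b \<oplus> w"
proof -
  let ?N = "{k \<odot> b \<oplus> w | k w. w \<in> vspan X B}"
  note S = submoduleD[OF submodule_vspan[OF B]]
  have "submodule ?N scalars X"
  proof (rule submoduleI')
    show "?N \<subseteq> carrier X" using S(1) b by auto
    show "\<zero> \<in> ?N" using S(2) b by (intro CollectI exI[of _ 0] exI[of _ \<zero>]) auto
    show "x \<oplus> y \<in> ?N" if "x \<in> ?N" "y \<in> ?N" for x y
    proof -
      obtain k w l u where *: "w \<in> vspan X B" "x = k \<odot> b \<oplus> w" "u \<in> vspan X B" "y = l \<odot> b \<oplus> u"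
        using \<open>x \<in> ?N\<close> \<open>y \<in> ?N\<close> by blast
      have c: "w \<in> carrier X" "u \<in> carrier X" "k \<odot> b \<in> carrier X" "l \<odot> b \<in> carrier X"
        using * S(1) b by auto
      have "x \<oplus> y = (k + l) \<odot> b \<oplus> (w \<oplus> u)"
        unfolding *(2,4) smult_add_left[OF b] using c by (simp add: M.a_ac)
      then show ?thesis using S(3)[OF *(1,3)] by blast
    qed
    show "a \<odot> x \<in> ?N" if "x \<in> ?N" for a x
    proof -
      obtain k w where *: "w \<in> vspan X B" "x = k \<odot> b \<oplus> w"
        using \<open>x \<in> ?N\<close> by blast
      have "a \<odot> x = (a * k) \<odot> b \<oplus> a \<odot> w"
        using * S(1) b by (auto simp: smult_add_right smult_smult)
      then show ?thesis using S(4)[OF *(1)] by blast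
    qed
  qed
  moreover have "insert b B \<subseteq> ?N"
  proof
    fix x assume "x \<in> insert b B"
    moreover have "b = 1 \<odot> b \<oplus> \<zero>" using b by simp
    moreover have "x = 0 \<odot> b \<oplus> x" if "x \<in> B" using that b B by auto
    ultimately show "x \<in> ?N" using S(2) vspan_superset[of B] by blast
  qed
  ultimately have "v \<in> ?N" using vspan_minimal v by blast
  then show thesis using that by blast
qed

text \<open>A subspace of a finitely spanned space has a finite spanning set of its own, as
  \<open>vdim\<close> demands. By induction on \<open>B\<close>, the part of \<open>V\<close> inside
  the span of \<open>B\<close> is spanned by some finite \<open>A\<close>. If \<open>V\<close> is
  larger, one more generator \<open>u\<close> with non-zero \<open>b\<close>-coefficient suffices:
  subtracting a multiple of \<open>u\<close> moves any vector of \<open>V\<close> into that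
  part.\<close>

lemma submodule_finitely_spanned:
  assumes "finite B" "B \<subseteq> carrier X" "submodule V scalars X" "V \<subseteq> vspan X B"
  shows "\<exists>A. finite A \<and> A \<subseteq> V \<and> vspan X A = V"
  using assms
proof (induction B arbitrary: V rule: finite_induct)
  case empty
  then have "V = {\<zero>}" using submoduleD(2) vspan_empty by auto
  then show ?case using vspan_empty by (intro exI[of _ "{}"]) auto
next
  case (insert b B)
  have b: "b \<in> carrier X" and B: "B \<subseteq> carrier X" using insert.prems by auto
  note V = submoduleD[OF insert.prems(2)]
  note S = submoduleD[OF submodule_vspan[OF B]]
  have "submodule (V \<inter> vspan X B) scalars X"
    using V S by (intro submoduleI') auto
  then obtain A where A: "finite A" "A \<subseteq> V \<inter> vspan X B" "vspan X A = V \<inter> vspan X B"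
    using insert.IH[OF B, of "V \<inter> vspan X B"] by auto
  show ?case
  proof (cases "V \<subseteq> vspan X B")
    case True
    then show ?thesis using A by (intro exI[of _ A]) auto
  next
    case False
    then obtain u where u: "u \<in> V" "u \<notin> vspan X B" by blast
    obtain k w where w: "w \<in> vspan X B" "u = k \<odot> b \<oplus> w"
      using vspan_insertD[OF B b] u(1) insert.prems(3) by blast
    \<comment> \<open>Otherwise \<open>u\<close> would equal \<open>w\<close> and lie in the span of
      \<open>B\<close>.\<close>
    have k: "k \<noteq> 0" using u(2) w b S(1) by auto
    have AV: "insert u A \<subseteq> V" using A u by auto
    then have Ac: "insert u A \<subseteq> carrier X" using V(1) by auto
    note I = submoduleD[OF submodule_vspan[OF Ac]]
    have "v \<in> vspan X (insert u A)" if v: "v \<in> V" for v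
    proof -
      obtain l z where z: "z \<in> vspan X B" "v = l \<odot> b \<oplus> z"
        using vspan_insertD[OF B b] v insert.prems(3) by blast
      \<comment> \<open>The multiple of \<open>u\<close> with the same \<open>b\<close>-coefficient
        as \<open>v\<close>; subtracting it eliminates \<open>b\<close>.\<close>
      define q where "q = l / k"
      have c: "w \<in> carrier X" "z \<in> carrier X" "u \<in> carrier X" "l \<odot> b \<in> carrier X"
        "v \<in> carrier X" using w z b u v V(1) S(1) by auto
      have qu: "q \<odot> u = l \<odot> b \<oplus> q \<odot> w"
        using k c b w by (simp add: smult_add_right smult_smult q_def)
      have eq: "v \<oplus> (- q) \<odot> u = z \<oplus> (- q) \<odot> w"
      proof -
        have m: "(- q) \<odot> y = \<ominus> (q \<odot> y)" if "y \<in> carrier X" for y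
          using that by (simp add: uminus_eq smult_smult)
        have "v \<oplus> \<ominus> (q \<odot> u) = z \<oplus> \<ominus> (q \<odot> w)"
          unfolding qu z(2) using c
          by (simp add: M.minus_add M.a_ac M.r_neg2)
        then show ?thesis using m c by simp
      qed
      have "v \<oplus> (- q) \<odot> u \<in> V" using V u v by auto
      moreover have "z \<oplus> (- q) \<odot> w \<in> vspan X B" using S w z by auto
      ultimately have "v \<oplus> (- q) \<odot> u \<in> vspan X A" using A eq by auto
      then have 1: "v \<oplus> (- q) \<odot> u \<in> vspan X (insert u A)"
        using vspan_mono[of A "insert u A"] by blast
      have 2: "q \<odot> u \<in> vspan X (insert u A)"
        using I(4) vspan_superset[of "insert u A"] by blast
      have "(v \<oplus> (- q) \<odot> u) \<oplus> q \<odot> u = v \<oplus> (- q + q) \<odot> u"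
        unfolding smult_add_left[OF c(3)] using c by (simp add: M.a_assoc)
      then show ?thesis using I(3)[OF 1 2] c by simp
    qed
    then show ?thesis
      using A(1) AV vspan_minimal[OF AV insert.prems(2)] by (intro exI[of _ "insert u A"]) auto
  qed
qed

text \<open>Frees the spanning set from lying inside \<open>V\<close>: the range of a sum of two
  operators can then be handled by the union of two spanning sets, which need not lie in that
  range.\<close>

lemma vdim_finite_iff:
  assumes "submodule V scalars X"
  shows "vdim X V < \<infinity> \<longleftrightarrow> (\<exists>B. finite B \<and> B \<subseteq> carrier X \<and> V \<subseteq> vspan X B)"
proof
  assume "vdim X V < \<infinity>"
  then obtain B where "finite B" "B \<subseteq> V" "vspan X B = V"
    unfolding vdim_def INF_less_iff by blast
  then show "\<exists>B. finite B \<and> B \<subseteq> carrier X \<and> V \<subseteq> vspan X B"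
    using submoduleD(1)[OF assms] by blast
next
  assume "\<exists>B. finite B \<and> B \<subseteq> carrier X \<and> V \<subseteq> vspan X B"
  then obtain A where "finite A" "A \<subseteq> V" "vspan X A = V"
    using submodule_finitely_spanned[OF _ _ assms] by blast
  then show "vdim X V < \<infinity>"
    unfolding vdim_def INF_less_iff by (intro bexI[of _ A]) auto
qed

section \<open>Behaviour of the distance under sums and multiples\<close>

lemma vdist_eq:
  "\<lbrakk>x \<in> carrier X; y \<in> carrier X\<rbrakk> \<Longrightarrow> vdist X x y = \<parallel>x \<oplus> \<ominus> y\<parallel>"
  by (simp add: vdist_def M.minus_eq)

lemma vdist_add:
  assumes "x \<in> carrier X" "y \<in> carrier X" "x' \<in> carrier X" "y' \<in> carrier X"
  shows "vdist X (x \<oplus> y) (x' \<oplus> y') \<le> vdist X x x' + vdist X y y'"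
proof -
  have "(x \<oplus> y) \<oplus> \<ominus> (x' \<oplus> y') = (x \<oplus> \<ominus> x') \<oplus> (y \<oplus> \<ominus> y')"
    using assms by (simp add: M.minus_add M.a_ac)
  then show ?thesis using assms vnorm_triangle[of "x \<oplus> \<ominus> x'" "y \<oplus> \<ominus> y'"] by (simp add: vdist_eq)
qed

lemma vdist_smult:
  assumes "x \<in> carrier X" "y \<in> carrier X"
  shows "vdist X (a \<odot> x) (a \<odot> y) = norm a * vdist X x y"
proof -
  have "a \<odot> x \<oplus> \<ominus> (a \<odot> y) = a \<odot> (x \<oplus> \<ominus> y)"
    using assms by (simp add: smult_add_right smult_minus_right)
  then show ?thesis using assms by (simp add: vdist_eq vnorm_smult)
qed

lemma vnorm_le_vdist:
  assumes "x \<in> carrier X" "y \<in> carrier X"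
  shows "\<parallel>x\<parallel> \<le> \<parallel>y\<parallel> + vdist X x y"
proof -
  have "x = y \<oplus> (x \<oplus> \<ominus> y)" using assms by (simp add: M.a_lcomm M.r_neg)
  then show ?thesis using assms vnorm_triangle[of y "x \<oplus> \<ominus> y"] by (simp add: vdist_eq)
qed

end

section \<open>The space of bounded operators\<close>

definition op_smult ::
    "('k::real_normed_field, 'u) nspace \<Rightarrow> ('k, 'v) nspace \<Rightarrow> 'k \<Rightarrow> ('u \<Rightarrow> 'v) \<Rightarrow> 'u \<Rightarrow> 'v" where
  "op_smult X Y a T = (\<lambda>x\<in>carrier X. a \<odot>\<^bsub>Y\<^esub> T x)"

locale operators = X: normed_vs X + Y: normed_vs Y
  for X :: "('k::real_normed_field, 'u) nspace" and Y :: "('k, 'v) nspace"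
begin

sublocale Ops: Metric_space "bounded_ops X Y" "op_dist X Y"
  by (rule Metric_space_op_dist) unfold_locales

sublocale Yd: Metric_space "carrier Y" "vdist Y"
  by (rule Y.Metric_space_vdist)

lemma bounded_opsD:
  assumes "T \<in> bounded_ops X Y"
  shows "\<And>x. x \<in> carrier X \<Longrightarrow> T x \<in> carrier Y"
    "\<And>x y. \<lbrakk>x \<in> carrier X; y \<in> carrier X\<rbrakk> \<Longrightarrow> T (x \<oplus>\<^bsub>X\<^esub> y) = T x \<oplus>\<^bsub>Y\<^esub> T y"
    "\<And>a x. x \<in> carrier X \<Longrightarrow> T (a \<odot>\<^bsub>X\<^esub> x) = a \<odot>\<^bsub>Y\<^esub> T x"
    "T \<in> extensional (carrier X)"
  using assms by (auto simp: bounded_ops_def linear_maps_def PiE_def)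

lemma bounded_opsI:
  assumes "\<And>x. x \<in> carrier X \<Longrightarrow> T x \<in> carrier Y"
    and "\<And>x y. \<lbrakk>x \<in> carrier X; y \<in> carrier X\<rbrakk> \<Longrightarrow> T (x \<oplus>\<^bsub>X\<^esub> y) = T x \<oplus>\<^bsub>Y\<^esub> T y"
    and "\<And>a x. x \<in> carrier X \<Longrightarrow> T (a \<odot>\<^bsub>X\<^esub> x) = a \<odot>\<^bsub>Y\<^esub> T x"
    and "T \<in> extensional (carrier X)"
    and "\<And>x. x \<in> carrier X \<Longrightarrow> \<parallel>T x\<parallel>\<^bsub>Y\<^esub> \<le> C * \<parallel>x\<parallel>\<^bsub>X\<^esub>"
  shows "T \<in> bounded_ops X Y"
proof -
  have "T \<in> linear_maps X Y" using assms(1-4) by (auto simp: linear_maps_def PiE_def)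
  then show ?thesis using assms(5) by (auto simp: bounded_ops_def)
qed

section \<open>The operator norm\<close>

lemma op_norm_nonneg:
  assumes "T \<in> bounded_ops X Y"
  shows "0 \<le> op_norm X Y T"
  using op_norm_upper[OF X.normed_vs_axioms assms, of "\<zero>\<^bsub>X\<^esub>"]
    Y.vnorm_nonneg[OF bounded_opsD(1)[OF assms X.M.zero_closed]] by simp

text \<open>\<open>op_norm\<close> is a supremum over the unit ball, so a non-zero \<open>x\<close>
  is first scaled to norm 1.\<close>

lemma op_norm_bound:
  assumes T: "T \<in> bounded_ops X Y" and x: "x \<in> carrier X"
  shows "\<parallel>T x\<parallel>\<^bsub>Y\<^esub> \<le> op_norm X Y T * \<parallel>x\<parallel>\<^bsub>X\<^esub>"
proof (cases "\<parallel>x\<parallel>\<^bsub>X\<^esub> = 0")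
  case True
  \<comment> \<open>Here \<open>x\<close> is zero, hence 0 times itself, and homogeneity of
    \<open>T\<close> carries this over to \<open>T x\<close>.\<close>
  then have "x = 0 \<odot>\<^bsub>X\<^esub> x" using X.vnorm_eq_0 x by simp
  then have "T x = 0 \<odot>\<^bsub>Y\<^esub> T x" using bounded_opsD(3)[OF T x, of 0] by simp
  then show ?thesis using True bounded_opsD(1)[OF T x] by simp
next
  case False
  then have pos: "0 < \<parallel>x\<parallel>\<^bsub>X\<^esub>" using X.vnorm_nonneg x by (simp add: order_less_le)
  \<comment> \<open>The scalar field is abstract, so the real factor is embedded by
    \<open>of_real\<close>, which preserves absolute values.\<close>
  define a :: 'k where "a = of_real (inverse \<parallel>x\<parallel>\<^bsub>X\<^esub>)"
  have na: "norm a = inverse \<parallel>x\<parallel>\<^bsub>X\<^esub>" unfolding a_def norm_of_real using pos by simp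
  have "\<parallel>T (a \<odot>\<^bsub>X\<^esub> x)\<parallel>\<^bsub>Y\<^esub> \<le> op_norm X Y T"
    using x pos by (intro op_norm_upper X.normed_vs_axioms T) (auto simp: X.vnorm_smult na)
  then show ?thesis
    using pos bounded_opsD(1)[OF T x]
    by (simp add: bounded_opsD(3)[OF T x] Y.vnorm_smult na field_simps)
qed

section \<open>Sums and multiples of operators\<close>

lemma op_add_bounded:
  assumes T: "T \<in> bounded_ops X Y" and S: "S \<in> bounded_ops X Y"
  shows "op_add X Y T S \<in> bounded_ops X Y"
proof (rule bounded_opsI[where C = "op_norm X Y T + op_norm X Y S"])
  fix x assume x: "x \<in> carrier X"
  show "\<parallel>op_add X Y T S x\<parallel>\<^bsub>Y\<^esub> \<le> (op_norm X Y T + op_norm X Y S) * \<parallel>x\<parallel>\<^bsub>X\<^esub>"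
    using Y.vnorm_triangle[of "T x" "S x"] op_norm_bound[OF T x] op_norm_bound[OF S x] x
      bounded_opsD(1)[OF T x] bounded_opsD(1)[OF S x]
    by (simp add: op_add_def distrib_right)
qed (use bounded_opsD[OF T] bounded_opsD[OF S] in
    \<open>auto simp: op_add_def Y.smult_add_right Y.M.a_ac\<close>)

lemma op_smult_bounded:
  assumes T: "T \<in> bounded_ops X Y"
  shows "op_smult X Y a T \<in> bounded_ops X Y"
proof (rule bounded_opsI[where C = "norm a * op_norm X Y T"])
  fix x assume x: "x \<in> carrier X"
  show "\<parallel>op_smult X Y a T x\<parallel>\<^bsub>Y\<^esub> \<le> norm a * op_norm X Y T * \<parallel>x\<parallel>\<^bsub>X\<^esub>"
    using op_norm_bound[OF T x] bounded_opsD(1)[OF T x] x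
    by (simp add: op_smult_def Y.vnorm_smult mult_left_mono mult.assoc)
qed (use bounded_opsD[OF T] in
    \<open>auto simp: op_smult_def Y.smult_add_right Y.smult_smult mult.commute\<close>)

lemma op_smult_smult:
  assumes "T \<in> bounded_ops X Y"
  shows "op_smult X Y a (op_smult X Y b T) = op_smult X Y (a * b) T"
  using bounded_opsD(1)[OF assms] by (auto simp: op_smult_def Y.smult_smult fun_eq_iff)

lemma op_smult_1:
  assumes "T \<in> bounded_ops X Y"
  shows "op_smult X Y 1 T = T"
  using bounded_opsD(1,4)[OF assms] by (auto simp: op_smult_def fun_eq_iff extensional_def)

lemma op_norm_smult_le:
  assumes T: "T \<in> bounded_ops X Y"
  shows "op_norm X Y (op_smult X Y a T) \<le> norm a * op_norm X Y T"
proof (rule op_norm_least[OF X.normed_vs_axioms])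
  fix x assume x: "x \<in> carrier X" "\<parallel>x\<parallel>\<^bsub>X\<^esub> \<le> 1"
  show "\<parallel>op_smult X Y a T x\<parallel>\<^bsub>Y\<^esub> \<le> norm a * op_norm X Y T"
    using op_norm_upper[OF X.normed_vs_axioms T x] bounded_opsD(1)[OF T] x
    by (simp add: op_smult_def Y.vnorm_smult mult_left_mono)
qed

text \<open>For non-zero \<open>a\<close> the reverse inequality is \<open>op_norm_smult_le\<close>
  applied to the multiple by \<open>inverse a\<close>, which restores \<open>T\<close>.\<close>

lemma op_norm_smult:
  assumes T: "T \<in> bounded_ops X Y"
  shows "op_norm X Y (op_smult X Y a T) = norm a * op_norm X Y T"
proof (cases "a = 0")
  case True
  then show ?thesis
    using op_norm_smult_le[OF T, of a] op_norm_nonneg[OF op_smult_bounded[OF T, of a]] by simp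
next
  case False
  have "op_norm X Y T = op_norm X Y (op_smult X Y (inverse a) (op_smult X Y a T))"
    using False op_smult_1[OF T] by (simp add: op_smult_smult[OF T])
  also have "\<dots> \<le> norm (inverse a) * op_norm X Y (op_smult X Y a T)"
    by (rule op_norm_smult_le[OF op_smult_bounded[OF T]])
  finally have "norm a * op_norm X Y T \<le> norm a * (norm (inverse a) * op_norm X Y (op_smult X Y a T))"
    by (rule mult_left_mono) simp
  also have "\<dots> = op_norm X Y (op_smult X Y a T)"
    using False by (simp add: norm_inverse)
  finally have "norm a * op_norm X Y T \<le> op_norm X Y (op_smult X Y a T)" .
  then show ?thesis using op_norm_smult_le[OF T, of a] by simp
qed

section \<open>The distance of operators\<close>

lemma op_dist_least:
  assumes T: "T \<in> bounded_ops X Y" and S: "S \<in> bounded_ops X Y"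
    and le: "\<And>x. \<lbrakk>x \<in> carrier X; \<parallel>x\<parallel>\<^bsub>X\<^esub> \<le> 1\<rbrakk> \<Longrightarrow> vdist Y (T x) (S x) \<le> c"
  shows "op_dist X Y T S \<le> c"
  unfolding op_dist_def using T S le bounded_opsD(1)[OF T] bounded_opsD(1)[OF S]
  by (auto intro!: op_norm_least[OF X.normed_vs_axioms] simp: op_minus_def vdist_def)

lemma vdist_op_dist:
  assumes T: "T \<in> bounded_ops X Y" and S: "S \<in> bounded_ops X Y" and x: "x \<in> carrier X"
  shows "vdist Y (T x) (S x) \<le> op_dist X Y T S * \<parallel>x\<parallel>\<^bsub>X\<^esub>"
proof -
  have "op_minus X Y T S \<in> bounded_ops X Y"
    by (rule op_minus_bounded[OF X.normed_vs_axioms Y.normed_vs_axioms T S])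
  from op_norm_bound[OF this x] show ?thesis
    using T S x bounded_opsD(1)[OF T x] bounded_opsD(1)[OF S x]
    by (simp add: op_dist_def op_minus_def vdist_def)
qed

lemma vdist_op_dist_1:
  assumes "T \<in> bounded_ops X Y" "S \<in> bounded_ops X Y" "x \<in> carrier X" "\<parallel>x\<parallel>\<^bsub>X\<^esub> \<le> 1"
  shows "vdist Y (T x) (S x) \<le> op_dist X Y T S"
  using vdist_op_dist[OF assms(1-3)] mult_left_mono[OF assms(4), of "op_dist X Y T S"]
  by simp

lemma op_dist_add:
  assumes "T \<in> bounded_ops X Y" "S \<in> bounded_ops X Y" "T' \<in> bounded_ops X Y"
    "S' \<in> bounded_ops X Y"
  shows "op_dist X Y (op_add X Y T S) (op_add X Y T' S') \<le> op_dist X Y T T' + op_dist X Y S S'"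
proof (intro op_dist_least op_add_bounded assms)
  fix x assume x: "x \<in> carrier X" "\<parallel>x\<parallel>\<^bsub>X\<^esub> \<le> 1"
  show "vdist Y (op_add X Y T S x) (op_add X Y T' S' x) \<le> op_dist X Y T T' + op_dist X Y S S'"
    using Y.vdist_add[of "T x" "S x" "T' x" "S' x"] assms x(1)
      vdist_op_dist_1[OF assms(1,3) x] vdist_op_dist_1[OF assms(2,4) x]
    by (simp add: op_add_def bounded_opsD(1))
qed

lemma op_dist_smult:
  assumes "T \<in> bounded_ops X Y" "S \<in> bounded_ops X Y"
  shows "op_dist X Y (op_smult X Y a T) (op_smult X Y a S) \<le> norm a * op_dist X Y T S"
proof (intro op_dist_least op_smult_bounded assms)
  fix x assume x: "x \<in> carrier X" "\<parallel>x\<parallel>\<^bsub>X\<^esub> \<le> 1"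
  show "vdist Y (op_smult X Y a T x) (op_smult X Y a S x) \<le> norm a * op_dist X Y T S"
    using vdist_op_dist_1[OF assms x] assms x(1)
    by (simp add: op_smult_def bounded_opsD(1) Y.vdist_smult mult_left_mono)
qed

text \<open>Controls how far one may move from the centre \<open>T\<close> of a ball in the
  direction \<open>S\<close>; the Baire argument needs this.\<close>

lemma op_dist_add_smult:
  assumes T: "T \<in> bounded_ops X Y" and S: "S \<in> bounded_ops X Y"
  shows "op_dist X Y T (op_add X Y T (op_smult X Y a S)) \<le> norm a * op_norm X Y S"
proof (intro op_dist_least op_add_bounded op_smult_bounded assms)
  fix x assume x: "x \<in> carrier X" "\<parallel>x\<parallel>\<^bsub>X\<^esub> \<le> 1"
  have c: "T x \<in> carrier Y" "S x \<in> carrier Y" using bounded_opsD(1) T S x by auto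
  have "vdist Y (op_add X Y T (op_smult X Y a S) x) (T x) = norm a * \<parallel>S x\<parallel>\<^bsub>Y\<^esub>"
  proof -
    have "T x \<oplus>\<^bsub>Y\<^esub> a \<odot>\<^bsub>Y\<^esub> S x \<oplus>\<^bsub>Y\<^esub> \<ominus>\<^bsub>Y\<^esub> T x = a \<odot>\<^bsub>Y\<^esub> S x"
      using c by (simp add: Y.M.a_comm Y.M.a_lcomm Y.M.r_neg1 Y.M.r_neg2)
    then show ?thesis
      using c x by (simp add: op_add_def op_smult_def Y.vdist_eq Y.vnorm_smult)
  qed
  then show "vdist Y (T x) (op_add X Y T (op_smult X Y a S) x) \<le> norm a * op_norm X Y S"
    using op_norm_upper[OF X.normed_vs_axioms S x]
    by (simp add: Yd.commute mult_left_mono)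
qed

section \<open>Finite rank and approximable operators\<close>

lemma image_submodule:
  assumes T: "T \<in> bounded_ops X Y"
  shows "submodule (T ` carrier X) scalars Y"
proof (rule Y.submoduleI')
  note D = bounded_opsD[OF T]
  have "T (0 \<odot>\<^bsub>X\<^esub> \<zero>\<^bsub>X\<^esub>) = 0 \<odot>\<^bsub>Y\<^esub> T \<zero>\<^bsub>X\<^esub>" by (rule D) simp
  then show "\<zero>\<^bsub>Y\<^esub> \<in> T ` carrier X" using D(1)[of "\<zero>\<^bsub>X\<^esub>"] by force
  show "T ` carrier X \<subseteq> carrier Y" using D by auto
  show "x \<oplus>\<^bsub>Y\<^esub> y \<in> T ` carrier X" if "x \<in> T ` carrier X" "y \<in> T ` carrier X" for x y
    using that D(2)[symmetric] by auto
  show "a \<odot>\<^bsub>Y\<^esub> x \<in> T ` carrier X" if "x \<in> T ` carrier X" for a x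
    using that D(3)[symmetric] by auto
qed

lemma finite_rank_ops_iff:
  "T \<in> finite_rank_ops X Y \<longleftrightarrow> T \<in> bounded_ops X Y \<and>
     (\<exists>B. finite B \<and> B \<subseteq> carrier Y \<and> T ` carrier X \<subseteq> vspan Y B)"
  using Y.vdim_finite_iff[OF image_submodule] by (auto simp: finite_rank_ops_def op_rank_def)

lemma finite_rank_add:
  assumes "T \<in> finite_rank_ops X Y" "S \<in> finite_rank_ops X Y"
  shows "op_add X Y T S \<in> finite_rank_ops X Y"
proof -
  obtain A B where A: "finite A" "A \<subseteq> carrier Y" "T ` carrier X \<subseteq> vspan Y A"
    and B: "finite B" "B \<subseteq> carrier Y" "S ` carrier X \<subseteq> vspan Y B"
    using assms by (auto simp: finite_rank_ops_iff)
  have AB: "A \<union> B \<subseteq> carrier Y" using A B by auto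
  have "op_add X Y T S ` carrier X \<subseteq> vspan Y (A \<union> B)"
    using A(3) B(3) Y.vspan_mono[of A "A \<union> B"] Y.vspan_mono[of B "A \<union> B"]
      Y.submoduleD(3)[OF Y.submodule_vspan[OF AB]]
    by (auto simp: op_add_def image_subset_iff subset_iff)
  then show ?thesis
    using A(1) B(1) AB assms op_add_bounded by (auto simp: finite_rank_ops_iff simp del: Un_subset_iff
      intro!: exI[of _ "A \<union> B"])
qed

lemma finite_rank_smult:
  assumes "T \<in> finite_rank_ops X Y"
  shows "op_smult X Y a T \<in> finite_rank_ops X Y"
proof -
  obtain A where A: "finite A" "A \<subseteq> carrier Y" "T ` carrier X \<subseteq> vspan Y A"
    using assms by (auto simp: finite_rank_ops_iff)
  have "op_smult X Y a T ` carrier X \<subseteq> vspan Y A"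
    using A(3) Y.submoduleD(4)[OF Y.submodule_vspan[OF A(2)]]
    by (auto simp: op_smult_def)
  then show ?thesis
    using A(1,2) assms op_smult_bounded by (auto simp: finite_rank_ops_iff)
qed

lemma approximable_ops_iff:
  "T \<in> approximable_ops X Y \<longleftrightarrow> T \<in> bounded_ops X Y \<and>
     (\<forall>r>0. \<exists>F\<in>finite_rank_ops X Y. op_dist X Y T F < r)"
  unfolding approximable_ops_def Ops.metric_closure_of
  by (auto simp: finite_rank_ops_def)

lemma approximable_bounded: "T \<in> approximable_ops X Y \<Longrightarrow> T \<in> bounded_ops X Y"
  by (simp add: approximable_ops_iff)

lemma finite_rank_bounded: "T \<in> finite_rank_ops X Y \<Longrightarrow> T \<in> bounded_ops X Y"
  by (simp add: finite_rank_ops_def)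

lemma approximable_add:
  assumes "T \<in> approximable_ops X Y" "S \<in> approximable_ops X Y"
  shows "op_add X Y T S \<in> approximable_ops X Y"
  unfolding approximable_ops_iff
proof (intro conjI allI impI)
  show "op_add X Y T S \<in> bounded_ops X Y"
    using assms approximable_bounded op_add_bounded by blast
  fix r :: real assume "r > 0"
  then obtain F G where "F \<in> finite_rank_ops X Y" "op_dist X Y T F < r / 2"
    "G \<in> finite_rank_ops X Y" "op_dist X Y S G < r / 2"
    using assms unfolding approximable_ops_iff by (meson half_gt_zero)
  then show "\<exists>F\<in>finite_rank_ops X Y. op_dist X Y (op_add X Y T S) F < r"
    using op_dist_add[of T S F G] assms approximable_bounded finite_rank_bounded
    by (intro bexI[of _ "op_add X Y F G"] finite_rank_add) auto
qed

lemma approximable_smult: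
  assumes "T \<in> approximable_ops X Y"
  shows "op_smult X Y a T \<in> approximable_ops X Y"
  unfolding approximable_ops_iff
proof (intro conjI allI impI)
  show "op_smult X Y a T \<in> bounded_ops X Y"
    using assms approximable_bounded op_smult_bounded by blast
  fix r :: real assume r: "r > 0"
  \<comment> \<open>The summand 1 keeps the denominator positive when \<open>a\<close> is
    zero.\<close>
  have pos: "norm a + 1 > 0" using norm_ge_zero[of a] by linarith
  obtain F where F: "F \<in> finite_rank_ops X Y" "op_dist X Y T F < r / (norm a + 1)"
    using assms r pos unfolding approximable_ops_iff by (meson divide_pos_pos)
  have "norm a * op_dist X Y T F \<le> (norm a + 1) * op_dist X Y T F"
    by (intro mult_right_mono) auto
  also have "\<dots> < r" using F(2) pos by (simp add: field_simps)
  finally show "\<exists>F\<in>finite_rank_ops X Y. op_dist X Y (op_smult X Y a T) F < r"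
    using op_dist_smult[of T F a] assms approximable_bounded finite_rank_bounded F
    by (intro bexI[of _ "op_smult X Y a F"] finite_rank_smult) auto
qed

text \<open>Together with completeness of the bounded operators, this makes the approximable
  operators a complete space, to which Baire's theorem applies.\<close>

lemma approximable_closedin: "closedin Ops.mtopology (approximable_ops X Y)"
  unfolding approximable_ops_def by (rule closedin_closure_of)

text \<open>A Cauchy sequence of operators converges pointwise; the Cauchy estimate survives the
  pointwise limit, which makes the convergence uniform on the unit ball.\<close>

lemma mcomplete_bounded_ops:
  assumes compl: "Yd.mcomplete"
  shows "Ops.mcomplete"
  unfolding Ops.mcomplete_def
proof (intro allI impI)
  fix \<sigma> assume C: "Ops.MCauchy \<sigma>"
  have \<sigma>: "\<sigma> n \<in> bounded_ops X Y" for n using C by (auto simp: Ops.MCauchy_def)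
  note c\<sigma> = bounded_opsD(1)[OF \<sigma>]
  have cauchy: "\<exists>N. \<forall>n\<ge>N. \<forall>m\<ge>N. op_dist X Y (\<sigma> n) (\<sigma> m) < e" if "e > 0" for e
    using C that unfolding Ops.MCauchy_def by metis
  have "\<exists>l. limitin Yd.mtopology (\<lambda>n. \<sigma> n x) l sequentially" if x: "x \<in> carrier X" for x
  proof -
    have n: "0 \<le> \<parallel>x\<parallel>\<^bsub>X\<^esub>" using X.vnorm_nonneg x .
    have "Yd.MCauchy (\<lambda>n. \<sigma> n x)"
      unfolding Yd.MCauchy_def
    proof (intro conjI allI impI)
      show "range (\<lambda>n. \<sigma> n x) \<subseteq> carrier Y" using c\<sigma> x by auto
      fix e :: real assume "e > 0"
      \<comment> \<open>As \<open>x\<close> may be zero, the Cauchy condition is used with its norm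
        increased by 1.\<close>
      then obtain N where N: "op_dist X Y (\<sigma> n) (\<sigma> m) < e / (\<parallel>x\<parallel>\<^bsub>X\<^esub> + 1)"
        if "n \<ge> N" "m \<ge> N" for n m
        using cauchy[of "e / (\<parallel>x\<parallel>\<^bsub>X\<^esub> + 1)"] n by auto
      have "vdist Y (\<sigma> n x) (\<sigma> m x) < e" if "n \<ge> N" "m \<ge> N" for n m
      proof -
        have "vdist Y (\<sigma> n x) (\<sigma> m x) \<le> op_dist X Y (\<sigma> n) (\<sigma> m) * \<parallel>x\<parallel>\<^bsub>X\<^esub>"
          by (rule vdist_op_dist[OF \<sigma> \<sigma> x])
        also have "\<dots> \<le> op_dist X Y (\<sigma> n) (\<sigma> m) * (\<parallel>x\<parallel>\<^bsub>X\<^esub> + 1)"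
          by (intro mult_left_mono) auto
        also have "\<dots> < e" using N[OF that] n by (simp add: field_simps)
        finally show ?thesis .
      qed
      then show "\<exists>N. \<forall>n n'. N \<le> n \<longrightarrow> N \<le> n' \<longrightarrow> vdist Y (\<sigma> n x) (\<sigma> n' x) < e" by blast
    qed
    then show ?thesis using compl by (simp add: Yd.mcomplete_def)
  qed
  then obtain L where L: "limitin Yd.mtopology (\<lambda>n. \<sigma> n x) (L x) sequentially"
    if "x \<in> carrier X" for x by metis
  \<comment> \<open>The restriction makes the limit extensional, as membership in
    \<open>bounded_ops\<close> requires.\<close>
  define T where "T = restrict L (carrier X)"
  have cT: "T x \<in> carrier Y" if "x \<in> carrier X" for x
    using L[OF that] that by (simp add: T_def Yd.limit_metric_sequentially)
  have pw: "\<exists>N. \<forall>n\<ge>N. vdist Y (\<sigma> n x) (T x) < e" if x: "x \<in> carrier X" and e: "e > 0" for x e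
  proof -
    have "limitin Yd.mtopology (\<lambda>n. \<sigma> n x) (T x) sequentially"
      using L[OF x] x by (simp add: T_def)
    then obtain N where "\<forall>n\<ge>N. \<sigma> n x \<in> carrier Y \<and> vdist Y (\<sigma> n x) (T x) < e"
      unfolding Yd.limit_metric_sequentially using e by blast
    then show ?thesis by blast
  qed
  have unif: "\<exists>N. \<forall>n\<ge>N. \<forall>x\<in>carrier X. vdist Y (\<sigma> n x) (T x) \<le> e * \<parallel>x\<parallel>\<^bsub>X\<^esub>" if e: "e > 0" for e
  proof -
    obtain N where N: "\<And>n m. \<lbrakk>n \<ge> N; m \<ge> N\<rbrakk> \<Longrightarrow> op_dist X Y (\<sigma> n) (\<sigma> m) < e"
      using cauchy[OF e] by auto
    \<comment> \<open>The auxiliary index \<open>m\<close> depends on \<open>x\<close> and on the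
      slack \<open>d\<close>, but \<open>N\<close> depends on neither; as \<open>d\<close> is
      arbitrary, the bound is uniform.\<close>
    have "vdist Y (\<sigma> n x) (T x) \<le> e * \<parallel>x\<parallel>\<^bsub>X\<^esub>" if n: "n \<ge> N" and x: "x \<in> carrier X" for n x
    proof (rule field_le_epsilon)
      fix d :: real assume "d > 0"
      then obtain M where M: "\<And>m. m \<ge> M \<Longrightarrow> vdist Y (\<sigma> m x) (T x) < d" using pw[OF x] by blast
      define m where "m = max N M"
      have "vdist Y (\<sigma> n x) (T x) \<le> vdist Y (\<sigma> n x) (\<sigma> m x) + vdist Y (\<sigma> m x) (T x)"
        using Yd.triangle[OF c\<sigma>[OF x] c\<sigma>[OF x] cT[OF x]] .
      also have "vdist Y (\<sigma> m x) (T x) \<le> d" using M[of m] by (simp add: m_def)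
      also have "vdist Y (\<sigma> n x) (\<sigma> m x) \<le> op_dist X Y (\<sigma> n) (\<sigma> m) * \<parallel>x\<parallel>\<^bsub>X\<^esub>"
        by (rule vdist_op_dist[OF \<sigma> \<sigma> x])
      also have "\<dots> \<le> e * \<parallel>x\<parallel>\<^bsub>X\<^esub>"
        using N[OF n, of m] X.vnorm_nonneg[OF x] by (intro mult_right_mono) (auto simp: m_def)
      finally show "vdist Y (\<sigma> n x) (T x) \<le> e * \<parallel>x\<parallel>\<^bsub>X\<^esub> + d" by simp
    qed
    then show ?thesis by blast
  qed
  have T: "T \<in> bounded_ops X Y"
  proof -
    obtain N where N: "\<And>x. x \<in> carrier X \<Longrightarrow> vdist Y (\<sigma> N x) (T x) \<le> 1 * \<parallel>x\<parallel>\<^bsub>X\<^esub>"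
      using unif[of 1] by auto
    \<comment> \<open>The constant is the norm of \<open>\<sigma> N\<close> plus the deviation 1 of
      the limit from \<open>\<sigma> N\<close>.\<close>
    show ?thesis
    proof (rule bounded_opsI[where C = "op_norm X Y (\<sigma> N) + 1"])
      fix x assume x: "x \<in> carrier X"
      show "\<parallel>T x\<parallel>\<^bsub>Y\<^esub> \<le> (op_norm X Y (\<sigma> N) + 1) * \<parallel>x\<parallel>\<^bsub>X\<^esub>"
        using Y.vnorm_le_vdist[OF cT[OF x] c\<sigma>[OF x, of N]] op_norm_bound[OF \<sigma>[of N] x] N[OF x]
        by (simp add: Yd.commute algebra_simps)
      show "T x \<in> carrier Y" by (rule cT[OF x])
      show "T (a \<odot>\<^bsub>X\<^esub> x) = a \<odot>\<^bsub>Y\<^esub> T x" for a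
      proof -
        have ax: "a \<odot>\<^bsub>X\<^esub> x \<in> carrier X" using x by simp
        have "vdist Y (T (a \<odot>\<^bsub>X\<^esub> x)) (a \<odot>\<^bsub>Y\<^esub> T x) \<le> 0 + e" if "e > 0" for e
        proof -
          \<comment> \<open>The two errors \<open>d\<close> and \<open>norm a * d\<close> then add
            up to exactly \<open>e\<close>.\<close>
          define d where "d = e / (norm a + 1)"
          have pos: "norm a + 1 > 0" using norm_ge_zero[of a] by linarith
          then have d: "d > 0" using that by (simp add: d_def)
          obtain N1 where N1: "\<And>n. n \<ge> N1 \<Longrightarrow> vdist Y (\<sigma> n x) (T x) < d"
            using pw[OF x d] by blast
          obtain N2 where N2: "\<And>n. n \<ge> N2 \<Longrightarrow> vdist Y (\<sigma> n (a \<odot>\<^bsub>X\<^esub> x)) (T (a \<odot>\<^bsub>X\<^esub> x)) < d"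
            using pw[OF ax d] by blast
          define n where "n = max N1 N2"
          have "vdist Y (T (a \<odot>\<^bsub>X\<^esub> x)) (a \<odot>\<^bsub>Y\<^esub> T x) \<le>
              vdist Y (T (a \<odot>\<^bsub>X\<^esub> x)) (\<sigma> n (a \<odot>\<^bsub>X\<^esub> x)) + vdist Y (\<sigma> n (a \<odot>\<^bsub>X\<^esub> x)) (a \<odot>\<^bsub>Y\<^esub> T x)"
            using cT c\<sigma> x by (intro Yd.triangle) auto
          also have "vdist Y (T (a \<odot>\<^bsub>X\<^esub> x)) (\<sigma> n (a \<odot>\<^bsub>X\<^esub> x)) \<le> d"
            using N2[of n] by (simp add: n_def Yd.commute)
          also have "vdist Y (\<sigma> n (a \<odot>\<^bsub>X\<^esub> x)) (a \<odot>\<^bsub>Y\<^esub> T x) = norm a * vdist Y (\<sigma> n x) (T x)"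
            using c\<sigma>[OF x] cT[OF x] x by (simp add: bounded_opsD(3)[OF \<sigma>] Y.vdist_smult)
          also have "\<dots> \<le> norm a * d"
            using N1[of n] by (intro mult_left_mono) (auto simp: n_def)
          also have "d + norm a * d = (norm a + 1) * d" by (simp add: algebra_simps)
          also have "\<dots> = e" using pos by (simp add: d_def)
          finally show ?thesis by simp
        qed
        then have "vdist Y (T (a \<odot>\<^bsub>X\<^esub> x)) (a \<odot>\<^bsub>Y\<^esub> T x) \<le> 0" by (rule field_le_epsilon)
        then show ?thesis
          using Yd.zero[of "T (a \<odot>\<^bsub>X\<^esub> x)" "a \<odot>\<^bsub>Y\<^esub> T x"] Yd.nonneg cT[OF x] cT[OF ax]
          by (simp add: order_antisym)
      qed
      fix y assume y: "y \<in> carrier X"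
      have xy: "x \<oplus>\<^bsub>X\<^esub> y \<in> carrier X" using x y by simp
      \<comment> \<open>Each of the three points \<open>x\<close>, \<open>y\<close> and their sum
        contributes an error of one third of \<open>e\<close>.\<close>
      have "vdist Y (T (x \<oplus>\<^bsub>X\<^esub> y)) (T x \<oplus>\<^bsub>Y\<^esub> T y) \<le> 0 + e" if "e > 0" for e
      proof -
        have d: "e / 3 > 0" using that by simp
        obtain N1 where N1: "\<And>n. n \<ge> N1 \<Longrightarrow> vdist Y (\<sigma> n x) (T x) < e / 3"
          using pw[OF x d] by blast
        obtain N2 where N2: "\<And>n. n \<ge> N2 \<Longrightarrow> vdist Y (\<sigma> n y) (T y) < e / 3"
          using pw[OF y d] by blast
        obtain N3 where N3: "\<And>n. n \<ge> N3 \<Longrightarrow> vdist Y (\<sigma> n (x \<oplus>\<^bsub>X\<^esub> y)) (T (x \<oplus>\<^bsub>X\<^esub> y)) < e / 3"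
          using pw[OF xy d] by blast
        define n where "n = max N1 (max N2 N3)"
        have "vdist Y (T (x \<oplus>\<^bsub>X\<^esub> y)) (T x \<oplus>\<^bsub>Y\<^esub> T y) \<le>
            vdist Y (T (x \<oplus>\<^bsub>X\<^esub> y)) (\<sigma> n (x \<oplus>\<^bsub>X\<^esub> y)) + vdist Y (\<sigma> n (x \<oplus>\<^bsub>X\<^esub> y)) (T x \<oplus>\<^bsub>Y\<^esub> T y)"
          using cT c\<sigma> x y by (intro Yd.triangle) auto
        also have "vdist Y (\<sigma> n (x \<oplus>\<^bsub>X\<^esub> y)) (T x \<oplus>\<^bsub>Y\<^esub> T y) \<le>
            vdist Y (\<sigma> n x) (T x) + vdist Y (\<sigma> n y) (T y)"
          unfolding bounded_opsD(2)[OF \<sigma> x y] using c\<sigma> cT x y by (intro Y.vdist_add) auto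
        finally show ?thesis
          using N1[of n] N2[of n] N3[of n]
            Yd.commute[of "T (x \<oplus>\<^bsub>X\<^esub> y)" "\<sigma> n (x \<oplus>\<^bsub>X\<^esub> y)"]
          unfolding n_def by linarith
      qed
      then have "vdist Y (T (x \<oplus>\<^bsub>X\<^esub> y)) (T x \<oplus>\<^bsub>Y\<^esub> T y) \<le> 0" by (rule field_le_epsilon)
      then show "T (x \<oplus>\<^bsub>X\<^esub> y) = T x \<oplus>\<^bsub>Y\<^esub> T y"
        using Yd.zero[of "T (x \<oplus>\<^bsub>X\<^esub> y)" "T x \<oplus>\<^bsub>Y\<^esub> T y"] Yd.nonneg cT[OF x] cT[OF y] cT[OF xy]
        by (simp add: order_antisym)
    qed (simp add: T_def)
  qed
  have "limitin Ops.mtopology \<sigma> T sequentially"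
    unfolding Ops.limit_metric_sequentially
  proof (intro conjI allI impI T)
    fix e :: real assume e: "e > 0"
    \<comment> \<open>Pointwise bounds give only a weak inequality for the supremum; half of
      \<open>e\<close> makes it strict.\<close>
    then obtain N where N: "\<And>n x. \<lbrakk>n \<ge> N; x \<in> carrier X\<rbrakk> \<Longrightarrow> vdist Y (\<sigma> n x) (T x) \<le> e / 2 * \<parallel>x\<parallel>\<^bsub>X\<^esub>"
      using unif[of "e / 2"] by auto
    have "op_dist X Y (\<sigma> n) T < e" if n: "n \<ge> N" for n
    proof -
      have "op_dist X Y (\<sigma> n) T \<le> e / 2"
      proof (rule op_dist_least[OF \<sigma> T])
        fix x assume x: "x \<in> carrier X" "\<parallel>x\<parallel>\<^bsub>X\<^esub> \<le> 1"
        show "vdist Y (\<sigma> n x) (T x) \<le> e / 2"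
          using N[OF n x(1)] mult_left_le[OF x(2), of "e / 2"] e by linarith
      qed
      then show ?thesis using e by simp
    qed
    then show "\<exists>N. \<forall>n\<ge>N. \<sigma> n \<in> bounded_ops X Y \<and> op_dist X Y (\<sigma> n) T < e"
      using \<sigma> by blast
  qed
  then show "\<exists>T. limitin Ops.mtopology \<sigma> T sequentially" by blast
qed

end

section \<open>Operators between Banach spaces and their s-numbers\<close>

locale s_numbers_pair = s_numbers_sequence s + X: banach_space X + Y: banach_space Y
  for s :: "('k::real_normed_field, 'u) nspace \<Rightarrow> ('k, 'u) nspace \<Rightarrow> ('u \<Rightarrow> 'u) \<Rightarrow> nat \<Rightarrow> real"
    and X Y :: "('k, 'u) nspace"
begin

sublocale operators X Y
  by unfold_locales

lemmas ban = X.banach_space_axioms Y.banach_space_axioms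

section \<open>Monotonicity, homogeneity and continuity of s-numbers\<close>

lemma s_antimono:
  assumes "T \<in> bounded_ops X Y" "1 \<le> m" "m \<le> n"
  shows "s X Y T n \<le> s X Y T m"
  using assms(3)
proof (induction n rule: dec_induct)
  case (step n)
  then show ?case using s_decreasing[OF ban assms(1), of n] assms(2) by simp
qed simp

lemma s_le_op_norm:
  assumes "T \<in> bounded_ops X Y" "1 \<le> n"
  shows "s X Y T n \<le> op_norm X Y T"
  using s_antimono[OF assms(1) order_refl assms(2)] s_one[OF ban assms(1)] by simp

text \<open>A multiple of \<open>T\<close> is \<open>T\<close> composed with multiplication by
  \<open>a\<close> on \<open>X\<close>, whose norm is at most \<open>norm a\<close>.
  Multiplicativity with index 1 for that factor turns its s-number into its norm and leaves
  \<open>n\<close> unshifted.\<close>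

lemma s_smult_le:
  assumes T: "T \<in> bounded_ops X Y" and n: "1 \<le> n"
  shows "s X Y (op_smult X Y a T) n \<le> norm a * s X Y T n"
proof -
  interpret XX: operators X X by unfold_locales
  let ?I = "\<lambda>x\<in>carrier X. a \<odot>\<^bsub>X\<^esub> x"
  have I: "?I \<in> bounded_ops X X"
    by (rule XX.bounded_opsI[where C = "norm a"])
      (auto simp: X.vnorm_smult X.smult_add_right X.smult_smult mult.commute)
  have "op_norm X X ?I \<le> norm a"
    by (rule op_norm_least[OF X.normed_vs_axioms])
      (auto simp: X.vnorm_smult intro: mult_left_le)
  moreover have "op_smult X Y a T = compose (carrier X) T ?I"
    using bounded_opsD(3)[OF T] by (auto simp: op_smult_def compose_def fun_eq_iff)
  ultimately have "s X Y (op_smult X Y a T) n \<le> s X Y T n * op_norm X X ?I"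
    using s_mult[OF ban(1,1,2) I T n, of 1] s_one[OF ban(1,1) I] by simp
  also have "\<dots> \<le> s X Y T n * norm a"
    using \<open>op_norm X X ?I \<le> norm a\<close> s_nonneg[OF ban T n] by (rule mult_left_mono)
  finally show ?thesis by (simp add: mult.commute)
qed

text \<open>Additivity for \<open>T\<close> as the sum of \<open>S\<close> and \<open>T - S\<close>,
  with index 1 for the difference. Thus each s-number is 1-Lipschitz, which makes the sets of the
  Baire argument closed.\<close>

lemma s_le_op_dist:
  assumes T: "T \<in> bounded_ops X Y" and S: "S \<in> bounded_ops X Y" and n: "1 \<le> n"
  shows "s X Y T n \<le> s X Y S n + op_dist X Y T S"
proof -
  have D: "op_minus X Y T S \<in> bounded_ops X Y"
    by (rule op_minus_bounded[OF X.normed_vs_axioms Y.normed_vs_axioms T S])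
  have "op_add X Y S (op_minus X Y T S) = T"
  proof (rule extensionalityI)
    show "op_add X Y S (op_minus X Y T S) \<in> extensional (carrier X)" by (simp add: op_add_def)
    show "T \<in> extensional (carrier X)" by (rule bounded_opsD(4)[OF T])
    fix x assume x: "x \<in> carrier X"
    have c: "T x \<in> carrier Y" "S x \<in> carrier Y" using bounded_opsD(1) T S x by auto
    have "S x \<oplus>\<^bsub>Y\<^esub> (T x \<oplus>\<^bsub>Y\<^esub> \<ominus>\<^bsub>Y\<^esub> S x) = T x \<oplus>\<^bsub>Y\<^esub> (S x \<oplus>\<^bsub>Y\<^esub> \<ominus>\<^bsub>Y\<^esub> S x)"
      using c by (intro Y.M.a_lcomm) auto
    also have "\<dots> = T x" using c by (simp add: Y.M.r_neg)
    finally show "op_add X Y S (op_minus X Y T S) x = T x"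
      using x by (simp add: op_add_def op_minus_def Y.M.minus_eq)
  qed
  then show ?thesis
    using s_add[OF ban S D n, of 1] s_one[OF ban D] T S by (simp add: op_dist_def)
qed

text \<open>Homogeneity reduces \<open>T\<close> to a multiple of norm 1. An operator of norm 0
  cannot be normalised, but all its s-numbers are at most 0.\<close>

lemma s_le_op_norm_times_s_sphere_bound:
  assumes "s_sphere s X Y n \<le> ereal c" "1 \<le> n" "T \<in> approximable_ops X Y"
  shows "s X Y T n \<le> op_norm X Y T * c"
proof -
  have T: "T \<in> bounded_ops X Y" using assms(3) by (rule approximable_bounded)
  show ?thesis
  proof (cases "op_norm X Y T = 0")
    case True
    then show ?thesis using s_le_op_norm[OF T assms(2)] by simp
  next
    case False
    define t where "t = op_norm X Y T"
    have t: "t > 0" using False op_norm_nonneg[OF T] by (simp add: t_def)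
    define U where "U = op_smult X Y (of_real (inverse t)) T"
    have U: "U \<in> approximable_ops X Y" unfolding U_def by (rule approximable_smult[OF assms(3)])
    have "op_norm X Y U = 1"
      unfolding U_def op_norm_smult[OF T] norm_of_real using t by (simp add: t_def)
    then have "ereal (s X Y U n) \<le> s_sphere s X Y n"
      unfolding s_sphere_def using U by (intro SUP_upper) auto
    then have "ereal (s X Y U n) \<le> ereal c" using assms(1) by (rule order_trans)
    then have Uc: "s X Y U n \<le> c" by simp
    \<comment> \<open>\<open>s_smult_le\<close> bounds a multiple from above, so \<open>T\<close>
      must appear as the multiple of \<open>U\<close>.\<close>
    have "T = op_smult X Y (of_real t) U"
      unfolding U_def op_smult_smult[OF T] using t op_smult_1[OF T]
      by (simp flip: of_real_mult)
    then have "s X Y T n \<le> norm (of_real t :: 'k) * s X Y U n"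
      using s_smult_le[OF approximable_bounded[OF U] assms(2)] by metis
    also have "\<dots> \<le> t * c" using Uc t by simp
    finally show ?thesis by (simp add: t_def)
  qed
qed

section \<open>From (b) to (a)\<close>

lemma s_sphere_bounded_below_if_no_common_rate:
  assumes rate: "\<And>\<epsilon> :: nat \<Rightarrow> real. \<lbrakk>antimono_on {1..} \<epsilon>; \<epsilon> \<longlonglongrightarrow> 0\<rbrakk> \<Longrightarrow>
    \<exists>T \<in> approximable_ops X Y. \<not> (\<exists>C. \<forall>n\<ge>1. s X Y T n \<le> C * \<epsilon> n)"
  shows "\<exists>c>0. \<forall>n\<ge>1. s_sphere s X Y n > ereal c"
proof (rule ccontr)
  assume "\<not> ?thesis"
  then have small: "\<exists>n\<ge>1. s_sphere s X Y n \<le> ereal c" if "c > 0" for c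
    using that by (meson not_le)
  define B where "B = {T \<in> approximable_ops X Y. op_norm X Y T \<le> 1}"
  \<comment> \<open>The 0 makes the set non-empty; it is the value at the zero operator.\<close>
  define \<epsilon> where "\<epsilon> n = Sup (insert 0 ((\<lambda>T. s X Y T n) ` B))" for n
  have bdd: "bdd_above (insert 0 ((\<lambda>T. s X Y T n) ` B))" if "1 \<le> n" for n
  proof (rule bdd_aboveI[where M = 1])
    fix x assume "x \<in> insert 0 ((\<lambda>T. s X Y T n) ` B)"
    then show "x \<le> 1"
      using s_le_op_norm[OF approximable_bounded that] by (force simp: B_def)
  qed
  have \<epsilon>_nonneg: "0 \<le> \<epsilon> n" if "1 \<le> n" for n
    unfolding \<epsilon>_def by (rule cSup_upper[OF _ bdd[OF that]]) simp
  have s_le_\<epsilon>: "s X Y T n \<le> \<epsilon> n" if "T \<in> B" "1 \<le> n" for T n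
    unfolding \<epsilon>_def using that by (intro cSup_upper bdd) auto
  have \<epsilon>_least: "\<epsilon> n \<le> c" if "0 \<le> c" "\<And>T. T \<in> B \<Longrightarrow> s X Y T n \<le> c" for n c
    unfolding \<epsilon>_def using that by (intro cSup_least) auto
  have mono: "\<epsilon> n \<le> \<epsilon> m" if "1 \<le> m" "m \<le> n" for m n
  proof (rule \<epsilon>_least)
    show "0 \<le> \<epsilon> m" using \<epsilon>_nonneg that by simp
    fix T assume "T \<in> B"
    then show "s X Y T n \<le> \<epsilon> m"
      using s_antimono[OF approximable_bounded that] s_le_\<epsilon>[of T m] that by (force simp: B_def)
  qed
  have "\<epsilon> \<longlonglongrightarrow> 0"
  proof (rule LIMSEQ_I)
    fix r :: real assume "r > 0"
    \<comment> \<open>The sphere bound passes to the unit ball since the factor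
      \<open>op_norm X Y T\<close> is at most 1 there; halving \<open>r\<close> gives the strict
      inequality.\<close>
    then obtain n where n: "n \<ge> 1" "s_sphere s X Y n \<le> ereal (r / 2)"
      using small[of "r / 2"] by auto
    have "\<epsilon> n \<le> r / 2"
    proof (rule \<epsilon>_least)
      fix T assume T: "T \<in> B"
      then have "s X Y T n \<le> op_norm X Y T * (r / 2)"
        using s_le_op_norm_times_s_sphere_bound[OF n(2,1)] by (simp add: B_def)
      also have "\<dots> \<le> 1 * (r / 2)"
        using T \<open>r > 0\<close> by (intro mult_right_mono) (auto simp: B_def)
      finally show "s X Y T n \<le> r / 2" by simp
    qed (use \<open>r > 0\<close> in simp)
    \<comment> \<open>The failure of (a) supplies a single index \<open>n\<close>; monotonicity
      carries its bound to all later ones.\<close>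
    then have "norm (\<epsilon> m - 0) < r" if "m \<ge> n" for m
      using mono[OF n(1) that] \<epsilon>_nonneg[of m] n(1) that \<open>r > 0\<close> by simp
    then show "\<exists>n0. \<forall>m\<ge>n0. norm (\<epsilon> m - 0) < r" by blast
  qed
  moreover have "antimono_on {1..} \<epsilon>"
    by (rule monotone_onI) (use mono in simp)
  ultimately obtain T where T: "T \<in> approximable_ops X Y"
    and no: "\<not> (\<exists>C. \<forall>n\<ge>1. s X Y T n \<le> C * \<epsilon> n)" using rate by blast
  \<comment> \<open>The unit sphere lies in \<open>B\<close>, so \<open>\<epsilon> n\<close> bounds
    its supremum, and \<open>op_norm X Y T\<close> becomes the constant that \<open>no\<close>
    excludes.\<close>
  have "s X Y T n \<le> op_norm X Y T * \<epsilon> n" if n: "1 \<le> n" for n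
  proof (rule s_le_op_norm_times_s_sphere_bound[OF _ n T])
    show "s_sphere s X Y n \<le> ereal (\<epsilon> n)"
      unfolding s_sphere_def using s_le_\<epsilon>[OF _ n] by (intro SUP_least) (auto simp: B_def)
  qed
  then show False using no by blast
qed

section \<open>From (a) to (b), by Baire's theorem\<close>

lemma no_common_rate_if_s_sphere_bounded_below:
  fixes \<epsilon> :: "nat \<Rightarrow> real"
  assumes c: "c > 0" "\<And>n. 1 \<le> n \<Longrightarrow> s_sphere s X Y n > ereal c"
    and mono: "antimono_on {1..} \<epsilon>" and lim: "\<epsilon> \<longlonglongrightarrow> 0"
  shows "\<exists>T \<in> approximable_ops X Y. \<not> (\<exists>C. \<forall>n\<ge>1. s X Y T n \<le> C * \<epsilon> n)"
proof (rule ccontr)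
  assume "\<not> ?thesis"
  then have rate: "\<exists>C. \<forall>n\<ge>1. s X Y T n \<le> C * \<epsilon> n" if "T \<in> approximable_ops X Y" for T
    using that by blast
  have large: "\<exists>T\<in>approximable_ops X Y. op_norm X Y T = 1 \<and> c < s X Y T n" if "1 \<le> n" for n
    using c(2)[OF that] by (auto simp: s_sphere_def less_SUP_iff)
  \<comment> \<open>A non-increasing sequence stays above its limit.\<close>
  have \<epsilon>_nonneg: "0 \<le> \<epsilon> n" if "1 \<le> n" for n
  proof (rule LIMSEQ_le_const2[OF lim])
    show "\<exists>N. \<forall>m\<ge>N. \<epsilon> m \<le> \<epsilon> n"
      using mono that by (intro exI[of _ n]) (auto simp: monotone_on_def)
  qed
  let ?A = "approximable_ops X Y"
  interpret A: Submetric "bounded_ops X Y" "op_dist X Y" ?A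
    by unfold_locales (use approximable_bounded in blast)
  have complete: "A.sub.mcomplete"
    using A.closedin_mcomplete_imp_mcomplete[OF approximable_closedin mcomplete_bounded_ops]
      Y.complete by blast
  \<comment> \<open>Natural numbers as constants keep the family countable, as Baire's theorem
    requires.\<close>
  define F where "F k = {T \<in> ?A. \<forall>n\<ge>1. s X Y T n \<le> real k * \<epsilon> n}" for k :: nat
  have closed: "closedin A.sub.mtopology (F k)" for k
    unfolding A.sub.metric_closedin_iff_sequentially_closed
  proof (intro conjI allI impI)
    show "F k \<subseteq> ?A" by (auto simp: F_def)
    fix \<sigma> T assume "range \<sigma> \<subseteq> F k \<and> limitin A.sub.mtopology \<sigma> T sequentially"
    then have \<sigma>: "\<And>i. \<sigma> i \<in> F k" and T: "T \<in> ?A"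
      and conv: "\<And>e. e > 0 \<Longrightarrow> \<exists>N. \<forall>i\<ge>N. \<sigma> i \<in> ?A \<and> op_dist X Y (\<sigma> i) T < e"
      by (auto simp: A.sub.limit_metric_sequentially)
    have "s X Y T n \<le> real k * \<epsilon> n" if n: "1 \<le> n" for n
    proof (rule field_le_epsilon)
      fix e :: real assume "e > 0"
      then obtain i where i: "\<sigma> i \<in> ?A" "op_dist X Y (\<sigma> i) T < e" using conv by blast
      have "s X Y T n \<le> s X Y (\<sigma> i) n + op_dist X Y T (\<sigma> i)"
        using i T n approximable_bounded by (intro s_le_op_dist) auto
      also have "s X Y (\<sigma> i) n \<le> real k * \<epsilon> n" using \<sigma>[of i] n by (simp add: F_def)
      finally show "s X Y T n \<le> real k * \<epsilon> n + e" using i(2) Ops.commute[of T "\<sigma> i"] by simp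
    qed
    then show "T \<in> F k" using T by (simp add: F_def)
  qed
  have cover: "\<Union>(range F) = ?A"
  proof
    show "\<Union>(range F) \<subseteq> ?A" by (auto simp: F_def)
    show "?A \<subseteq> \<Union>(range F)"
    proof
      fix T assume T: "T \<in> ?A"
      obtain C where C: "\<And>n. 1 \<le> n \<Longrightarrow> s X Y T n \<le> C * \<epsilon> n" using rate[OF T] by blast
      \<comment> \<open>Rounding the constant up preserves the bound because
        \<open>\<epsilon>\<close> is non-negative.\<close>
      obtain k :: nat where k: "C \<le> real k" using real_arch_simple by blast
      have "s X Y T n \<le> real k * \<epsilon> n" if "1 \<le> n" for n
        using C[OF that] mult_right_mono[OF k \<epsilon>_nonneg[OF that]] by simp
      then show "T \<in> \<Union>(range F)" using T by (auto simp: F_def)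
    qed
  qed
  \<comment> \<open>The whole space is open in itself, and (a) at index 1 shows that it is
    non-empty.\<close>
  have "A.sub.mtopology interior_of ?A = ?A"
    using interior_of_topspace[of A.sub.mtopology] by simp
  then have "A.sub.mtopology interior_of \<Union>(range F) \<noteq> {}"
    using large[of 1] cover by auto
  moreover have "A.sub.mtopology interior_of \<Union>(range F) = {}"
    if "\<forall>k. A.sub.mtopology interior_of F k = {}"
    using that closed by (intro A.sub.metric_Baire_category_alt[OF complete]) auto
  ultimately obtain k where "A.sub.mtopology interior_of F k \<noteq> {}" by blast
  then obtain T0 r where T0: "T0 \<in> ?A" and r: "r > 0" and ball: "A.sub.mball T0 r \<subseteq> F k"
    by (auto simp: A.sub.metric_interior_of)
  \<comment> \<open>Moving from \<open>T0\<close> by \<open>a\<close> times an operator of norm 1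
    stays inside the open ball.\<close>
  define a where "a = r / 2"
  have a: "a > 0" "a < r" using r by (auto simp: a_def)
  \<comment> \<open>The operator \<open>a T\<close> is the difference of \<open>T0 + a T\<close> and
    \<open>T0\<close>, both in \<open>F k\<close>. Additivity with both indices equal to
    \<open>n\<close> gives the index \<open>2 * n - 1\<close> and twice the bound
    \<open>real k * \<epsilon> n\<close>; homogeneity divides by \<open>a\<close>.\<close>
  have bound: "s X Y T (2 * n - 1) \<le> 2 * real k / a * \<epsilon> n"
    if T: "T \<in> ?A" "op_norm X Y T = 1" and n: "1 \<le> n" for T n
  proof -
    note bT = approximable_bounded[OF T(1)] and bT0 = approximable_bounded[OF T0]
    define S where "S = op_add X Y T0 (op_smult X Y (of_real a) T)"
    have SA: "S \<in> ?A" unfolding S_def by (intro approximable_add approximable_smult T0 T)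
    note bS = approximable_bounded[OF SA]
    have "op_dist X Y T0 S \<le> norm (of_real a :: 'k) * op_norm X Y T"
      unfolding S_def by (rule op_dist_add_smult[OF bT0 bT])
    then have "op_dist X Y T0 S < r" unfolding norm_of_real using T(2) a by simp
    then have "S \<in> F k" "T0 \<in> F k" using ball SA T0 r by auto
    then have Sn: "s X Y S n \<le> real k * \<epsilon> n" "s X Y T0 n \<le> real k * \<epsilon> n"
      using n by (auto simp: F_def)
    define N where "N = op_smult X Y (-1) T0"
    have bN: "N \<in> bounded_ops X Y" unfolding N_def by (rule op_smult_bounded[OF bT0])
    have Nn: "s X Y N n \<le> real k * \<epsilon> n"
      unfolding N_def using s_smult_le[OF bT0 n, of "-1"] Sn(2) by simp
    have "op_add X Y S N = op_smult X Y (of_real a) T"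
    proof
      fix x show "op_add X Y S N x = op_smult X Y (of_real a) T x"
        using bounded_opsD(1)[OF bT] bounded_opsD(1)[OF bT0]
        by (cases "x \<in> carrier X")
          (simp_all add: op_add_def op_smult_def S_def N_def Y.uminus_eq[symmetric]
            Y.M.a_comm Y.M.a_lcomm Y.M.r_neg1 Y.M.r_neg2)
    qed
    then have "T = op_smult X Y (inverse (of_real a)) (op_add X Y S N)"
      using a op_smult_1[OF bT] by (simp add: op_smult_smult[OF bT])
    then have "s X Y T (2 * n - 1) \<le>
        norm (inverse (of_real a :: 'k)) * s X Y (op_add X Y S N) (2 * n - 1)"
      using s_smult_le[OF op_add_bounded[OF bS bN], of "2 * n - 1" "inverse (of_real a)"] n
      by simp
    also have "\<dots> = s X Y (op_add X Y S N) (2 * n - 1) / a"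
      using a by (simp add: norm_inverse divide_inverse mult.commute)
    also have "\<dots> \<le> (real k * \<epsilon> n + real k * \<epsilon> n) / a"
    proof (rule divide_right_mono)
      have "s X Y (op_add X Y S N) (n + n - 1) \<le> s X Y S n + s X Y N n"
        by (rule s_add[OF ban bS bN n n])
      also have "\<dots> \<le> real k * \<epsilon> n + real k * \<epsilon> n" using Sn(1) Nn by (rule add_mono)
      finally show "s X Y (op_add X Y S N) (2 * n - 1) \<le> real k * \<epsilon> n + real k * \<epsilon> n"
        by (simp only: mult_2)
    qed (use a in simp)
    finally show ?thesis by simp
  qed
  have "c \<le> 2 * real k / a * \<epsilon> n" if n: "1 \<le> n" for n
  proof -
    have "1 \<le> 2 * n - 1" using n by simp
    \<comment> \<open>The lower bound is taken at the index \<open>2 * n - 1\<close> that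
      \<open>bound\<close> controls by \<open>\<epsilon> n\<close>, so \<open>c\<close> stays below
      a null sequence.\<close>
    then obtain T where "T \<in> ?A" "op_norm X Y T = 1" "c < s X Y T (2 * n - 1)"
      using large by blast
    then show ?thesis using bound[OF _ _ n, of T] by simp
  qed
  moreover have "(\<lambda>n. 2 * real k / a * \<epsilon> n) \<longlonglongrightarrow> 2 * real k / a * 0"
    by (intro tendsto_mult_left lim)
  ultimately have "c \<le> 2 * real k / a * 0"
    by (intro LIMSEQ_le_const) auto
  then show False using c(1) by simp
qed

end

theorem theorem3p3:
  fixes s :: "('k::real_normed_field, 'u) nspace \<Rightarrow> ('k, 'u) nspace \<Rightarrow> ('u \<Rightarrow> 'u) \<Rightarrow> nat \<Rightarrow> real"
    and X Y :: "('k, 'u) nspace"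
  assumes "s_numbers_sequence s"
    and "banach_space X"
    and "banach_space Y"
  shows "(\<exists>c>0. \<forall>n\<ge>1. s_sphere s X Y n > ereal c) \<longleftrightarrow>
    (\<forall>\<epsilon> :: nat \<Rightarrow> real. antimono_on {1..} \<epsilon> \<and> \<epsilon> \<longlonglongrightarrow> 0 \<longrightarrow>
      (\<exists>T \<in> approximable_ops X Y. \<not> (\<exists>C. \<forall>n\<ge>1. s X Y T n \<le> C * \<epsilon> n)))"
proof -
  interpret s_numbers_pair s X Y
    using assms by (rule s_numbers_pair.intro)
  show ?thesis
    using s_sphere_bounded_below_if_no_common_rate no_common_rate_if_s_sphere_bounded_below by blast
qed

end
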